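(* Let $(\mathcal{A},\varphi)$ be a non-commutative probability space, and let $a_1,\dots,a_k\in\mathcal{A}$ be such that $\varphi(a_1)=\cdots=\varphi(a_k)=1$. Let $\mu\in\mathcal{G}_k$ be the distribution of the $k$-tuple $(a_1,\dots,a_k)$, and for $1\le i\le k$ let $\mu_i\in\mathcal{G}_1$ be the distribution of $a_i$. The following statements are equivalent: (1) The elements $a_1,\dots,a_k$ form a freely independent family in $(\mathcal{A},\varphi)$. (2) The $LS$-transform of $\mu$ separates the variables; that is, there exist series $u_1,\dots,u_k\in\mathbb{C}[[z]]$ such that $LS_\mu(z_1,\dots,z_k)=u_1(z_1)+\cdots+u_k(z_k)$. (3) One has $LS_\mu(z_1,\dots,z_k)=LS_{\mu_1}(z_1)+\cdots+LS_{\mu_k}(z_k)$.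
   Context: Distributions. A non-commutative probability space is a pair $(\mathcal{A},\varphi)$ with $\mathcal{A}$ a unital algebra over $\mathbb{C}$ and $\varphi:\mathcal{A}\to\mathbb{C}$ linear with $\varphi(1_{\mathcal{A}})=1$. The distribution of $(a_1,\dots,a_k)\in\mathcal{A}^k$ is the linear functional $\mu$ on $\mathbb{C}\langle X_1,\dots,X_k\rangle$ (non-commutative polynomials) with $\mu(X_{i_1}\cdots X_{i_n})=\varphi(a_{i_1}\cdots a_{i_n})$ for all $n\ge 0$ and all indices. $\mathcal{G}_k$ is the set of linear functionals $\mu$ on $\mathbb{C}\langle X_1,\dots,X_k\rangle$ with $\mu(1)=1$ and $\mu(X_i)=1$ for $1\le i\le k$. The family $a_1,\dots,a_k$ is freely independent if $\varphi(c_1\cdots c_n)=0$ whenever $n\ge1$, $c_j$ is in the unital subalgebra generated by $a_{i_j}$, $\varphi(c_j)=0$ for all $j$, and $i_j\ne i_{j+1}$ for $1\le j<n$. Words and non-crossing partitions. $[k]^*$ is the set of finite words over $\{1,\dots,k\}$, $|w|$ is the length of $w$. For $w=(i_1,\dots,i_n)$ and $B=\{b_1<\dots<b_m\}\subseteq\{1,\dots,n\}$, $w|B:=(i_{b_1},\dots,i_{b_m})$. $NC(n)$ is the lattice of non-crossing partitions of $\{1,\dots,n\}$ ordered by reversed refinement, with minimum $0_n$ (all blocks singletons) and maximum $1_n$ (one block). For $\pi\in NC(n)$, $P_\pi$ is the permutation of $\{1,\dots,n\}$ which maps cyclically $b_1\mapsto b_2\mapsto\cdots\mapsto b_m\mapsto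 b_1$ on every block $\{b_1<\dots<b_m\}$ of $\pi$. The Kreweras complement $K(\pi)\in NC(n)$ is determined by $P_{K(\pi)}=P_\pi^{-1}P_{1_n}$ (composition of maps). $R$-transform. For a power series $f$ with vanishing constant term in non-commuting indeterminates $z_1,\dots,z_k$, $\mathrm{Cf}_w(f)$ is the coefficient of $z_w:=z_{i_1}\cdots z_{i_n}$ in $f$ ($w=(i_1,\dots,i_n)$, $n\ge1$), and $\mathrm{Cf}_{w;\pi}(f):=\prod_{B\text{ block of }\pi}\mathrm{Cf}_{w|B}(f)$ for $\pi\in NC(n)$. $R_\mu$ is the unique such series with $\mu(X_{i_1}\cdots X_{i_n})=\sum_{\pi\in NC(n)}\mathrm{Cf}_{(i_1,\dots,i_n);\pi}(R_\mu)$ for all $n\ge1$ and all indices. The Hopf algebra $\mathcal{Y}^{(k)}$. As an algebra, $\mathcal{Y}^{(k)}=\mathbb{C}[Y_w\mid w\in[k]^*,|w|\ge2]$ (commutative polynomials). Put $Y_w:=1$ if $|w|=1$, and $Y_{w;\pi}:=\prod_{A\text{ block of }\pi}Y_{w|A}$ for $|w|=n$, $\pi\in NC(n)$. The comultiplication $\Delta$ is the unital algebra homomorphism with $\Delta(Y_w)=\sum_{\pi\in NC(n)}Y_{w;\pi}\otimes Y_{w;K(\pi)}$ for $|w|=n\ge2$, and the counit $\varepsilon$ is the unital algebra homomorphism with $\varepsilon(Y_w)=0$ for $|w|\ge2$. With these, $\mathcal{Y}^{(k)}$ is a graded connected Hopf algebra, $Y_w$ being homogeneous of degree $|w|-1$.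 The convolution of linear functionals $\xi,\eta$ on $\mathcal{Y}^{(k)}$ is $\xi\eta:=(\xi\otimes\eta)\circ\Delta$. For a linear functional $\eta$ with $\eta(1)=1$, $\log\eta:=-\sum_{\ell=1}^\infty\frac1\ell(\varepsilon-\eta)^\ell$ (convolution powers; on each homogeneous component only finitely many terms are non-zero). $LS$-transform. For $\mu\in\mathcal{G}_k$, $\chi_\mu:\mathcal{Y}^{(k)}\to\mathbb{C}$ is the unital algebra homomorphism with $\chi_\mu(Y_w)=\mathrm{Cf}_w(R_\mu)$ for all $|w|\ge2$, and $LS_\mu(z_1,\dots,z_k):=\sum_{w\in[k]^*,|w|\ge2}\big((\log\chi_\mu)(Y_w)\big)z_w$, a power series in non-commuting indeterminates (for $k=1$, a series in $\mathbb{C}[[z]]$). *)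

theory Defs
  imports
    Complex_Main
    "HOL-Library.Poly_Mapping"
    "HOL-Library.Product_Plus"
    "HOL-Library.Disjoint_Sets"
    "HOL-Computational_Algebra.Formal_Power_Series"
begin

section \<open>Non-commutative probability spaces and free independence\<close>

locale nc_probability_space = vector_space sc
  for sc :: "complex \<Rightarrow> 'a::ring_1 \<Rightarrow> 'a" +
  fixes \<phi> :: "'a \<Rightarrow> complex"
  assumes scale_mult_left: "sc c x * y = sc c (x * y)"
    and scale_mult_right: "x * sc c y = sc c (x * y)"
    and linear_functional: "Vector_Spaces.linear sc (*) \<phi>"
    and functional_one: "\<phi> 1 = 1"

definition unital_subalgebra :: "(complex \<Rightarrow> 'a::ring_1 \<Rightarrow> 'a) \<Rightarrow> 'a set \<Rightarrow> bool" where
  "unital_subalgebra sc B \<longleftrightarrow>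
     module.subspace sc B \<and> 1 \<in> B \<and> (\<forall>x\<in>B. \<forall>y\<in>B. x * y \<in> B)"

definition freely_independent ::
    "(complex \<Rightarrow> 'a::ring_1 \<Rightarrow> 'a) \<Rightarrow> ('a \<Rightarrow> complex) \<Rightarrow> ('i \<Rightarrow> 'a) \<Rightarrow> bool" where
  "freely_independent sc \<phi> a \<longleftrightarrow>
     (\<forall>is cs. is \<noteq> [] \<and> length cs = length is \<and> distinct_adj is \<and>
        (\<forall>j<length is. cs ! j \<in> unital_subalgebra sc hull {a (is ! j)} \<and> \<phi> (cs ! j) = 0)
        \<longrightarrow> \<phi> (prod_list cs) = 0)"

section \<open>Non-commutative polynomials and distributions\<close>

text \<open>Letters are the elements of a type \<open>'i\<close>, with \<open>CARD('i) = k\<close>. Words form the free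
  monoid, written additively as the class \<^class>\<open>monoid_add\<close> requires; the algebra
  \<open>\<complex>\<langle>X\<^sub>1,\<dots>,X\<^sub>k\<rangle>\<close> is then the monoid algebra provided by
  \<^theory>\<open>HOL-Library.Poly_Mapping\<close>.\<close>

instantiation list :: (type) monoid_add
begin
definition zero_list :: "'a list" where "zero_list = []"
definition plus_list :: "'a list \<Rightarrow> 'a list \<Rightarrow> 'a list" where "plus_list = (@)"
instance by standard (simp_all add: zero_list_def plus_list_def)
end

type_synonym 'i ncpoly = "'i list \<Rightarrow>\<^sub>0 complex"

definition ncX :: "'i \<Rightarrow> 'i ncpoly" where
  "ncX i = Poly_Mapping.single [i] 1"

lemma prod_list_ncX: "prod_list (map ncX w) = Poly_Mapping.single w 1"
proof (induction w)
  case Nil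
  have "Poly_Mapping.single ([] :: 'a list) (1 :: complex) = 1"
    by (simp flip: zero_list_def)
  then show ?case by simp
next
  case (Cons i w)
  then show ?case by (simp add: ncX_def mult_single plus_list_def)
qed

definition distribution :: "('a::ring_1 \<Rightarrow> complex) \<Rightarrow> ('i \<Rightarrow> 'a) \<Rightarrow> 'i ncpoly \<Rightarrow> complex" where
  "distribution \<phi> a p =
     (\<Sum>w\<in>Poly_Mapping.keys p. Poly_Mapping.lookup p w * \<phi> (prod_list (map a w)))"

text \<open>The set \<open>\<G>\<^sub>k\<close>; multiplication by \<^term>\<open>Poly_Mapping.single 0 c\<close> is scalar multiplication
  by \<open>c\<close>.\<close>

definition normalized_functionals :: "('i ncpoly \<Rightarrow> complex) set" where
  "normalized_functionals =
     {\<mu>. (\<forall>p q. \<mu> (p + q) = \<mu> p + \<mu> q) \<and> (\<forall>c p. \<mu> (Poly_Mapping.single 0 c * p) = c * \<mu> p) \<and>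
        \<mu> 1 = 1 \<and> (\<forall>i. \<mu> (ncX i) = 1)}"

section \<open>Non-crossing partitions\<close>

text \<open>The positions of a word of length \<open>n\<close> are \<open>0,\<dots>,n-1\<close>, as for \<^const>\<open>nths\<close>, so that
  \<open>w|B\<close> is \<^term>\<open>nths w B\<close>.\<close>

definition NC :: "nat \<Rightarrow> nat set set set" where
  "NC n = {\<pi>. partition_on {..<n} \<pi> \<and>
     \<not> (\<exists>A\<in>\<pi>. \<exists>B\<in>\<pi>. A \<noteq> B \<and>
          (\<exists>a b c d. a < b \<and> b < c \<and> c < d \<and> a \<in> A \<and> c \<in> A \<and> b \<in> B \<and> d \<in> B))}"

definition block_perm :: "nat set set \<Rightarrow> nat \<Rightarrow> nat" where
  "block_perm \<pi> x =
     (if x \<in> \<Union>\<pi> then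
        (let B = (THE B. B \<in> \<pi> \<and> x \<in> B)
         in if \<exists>y\<in>B. x < y then Min {y\<in>B. x < y} else Min B)
      else x)"

definition kreweras :: "nat \<Rightarrow> nat set set \<Rightarrow> nat set set" where
  "kreweras n \<pi> =
     (THE \<sigma>. \<sigma> \<in> NC n \<and> block_perm \<sigma> = inv (block_perm \<pi>) \<circ> block_perm {{..<n}})"

section \<open>The \<open>R\<close>-transform\<close>

text \<open>A power series in non-commuting indeterminates is its coefficient function.\<close>

type_synonym 'i ncps = "'i list \<Rightarrow> complex"

definition Cf_part :: "'i list \<Rightarrow> nat set set \<Rightarrow> 'i ncps \<Rightarrow> complex" where
  "Cf_part w \<pi> f = (\<Prod>B\<in>\<pi>. f (nths w B))"

definition R_transform :: "('i ncpoly \<Rightarrow> complex) \<Rightarrow> 'i ncps" where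
  "R_transform \<mu> =
     (THE f. f [] = 0 \<and>
        (\<forall>w. w \<noteq> [] \<longrightarrow> \<mu> (prod_list (map ncX w)) = (\<Sum>\<pi>\<in>NC (length w). Cf_part w \<pi> f)))"

section \<open>The Hopf algebra \<open>\<Y>\<close>\<close>

typedef 'i yword = "{w :: 'i list. 2 \<le> length w}"
  morphisms letters Yword
  by (rule exI[of _ "[undefined, undefined]"]) simp

type_synonym 'i ymon = "'i yword \<Rightarrow>\<^sub>0 nat"
type_synonym 'i yalg = "'i ymon \<Rightarrow>\<^sub>0 complex"

text \<open>The tensor square of \<^typ>\<open>'i yalg\<close>, on the basis of pairs of monomials (which multiply
  componentwise).\<close>

type_synonym 'i yalg2 = "('i ymon \<times> 'i ymon) \<Rightarrow>\<^sub>0 complex"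

text \<open>The value on the empty word is never used.\<close>

definition Y :: "'i list \<Rightarrow> 'i yalg" where
  "Y w = (if 2 \<le> length w then Poly_Mapping.single (Poly_Mapping.single (Yword w) 1) 1 else 1)"

definition Y_part :: "'i list \<Rightarrow> nat set set \<Rightarrow> 'i yalg" where
  "Y_part w \<pi> = (\<Prod>A\<in>\<pi>. Y (nths w A))"

definition tensor :: "'i yalg \<Rightarrow> 'i yalg \<Rightarrow> 'i yalg2" where
  "tensor p q =
     (\<Sum>m\<in>Poly_Mapping.keys p. \<Sum>n\<in>Poly_Mapping.keys q.
        Poly_Mapping.single (m, n) (Poly_Mapping.lookup p m * Poly_Mapping.lookup q n))"

text \<open>The unital homomorphism with \<open>Y w \<mapsto> g w\<close> for \<open>|w| \<ge> 2\<close>, into a commutative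
  algebra whose scalars are embedded by \<open>\<iota>\<close> (see \<open>yalg_hom_mult\<close> and \<open>yalg_hom_Y\<close> below).\<close>

definition ymon_eval :: "('i list \<Rightarrow> 'b::comm_ring_1) \<Rightarrow> 'i ymon \<Rightarrow> 'b" where
  "ymon_eval g m = (\<Prod>v\<in>Poly_Mapping.keys m. g (letters v) ^ Poly_Mapping.lookup m v)"

definition yalg_hom ::
    "(complex \<Rightarrow> 'b::comm_ring_1) \<Rightarrow> ('i list \<Rightarrow> 'b) \<Rightarrow> 'i yalg \<Rightarrow> 'b" where
  "yalg_hom \<iota> g p =
     (\<Sum>m\<in>Poly_Mapping.keys p. \<iota> (Poly_Mapping.lookup p m) * ymon_eval g m)"

definition comult :: "'i yalg \<Rightarrow> 'i yalg2" where
  "comult = yalg_hom (Poly_Mapping.single 0)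
     (\<lambda>w. \<Sum>\<pi>\<in>NC (length w). tensor (Y_part w \<pi>) (Y_part w (kreweras (length w) \<pi>)))"

definition counit :: "'i yalg \<Rightarrow> complex" where
  "counit = yalg_hom id (\<lambda>w. 0)"

definition tensor_functional ::
    "('i yalg \<Rightarrow> complex) \<Rightarrow> ('i yalg \<Rightarrow> complex) \<Rightarrow> 'i yalg2 \<Rightarrow> complex" where
  "tensor_functional \<xi> \<eta> t =
     (\<Sum>(m, n)\<in>Poly_Mapping.keys t. Poly_Mapping.lookup t (m, n) *
        (\<xi> (Poly_Mapping.single m 1) * \<eta> (Poly_Mapping.single n 1)))"

definition convolution ::
    "('i yalg \<Rightarrow> complex) \<Rightarrow> ('i yalg \<Rightarrow> complex) \<Rightarrow> 'i yalg \<Rightarrow> complex" where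
  "convolution \<xi> \<eta> = tensor_functional \<xi> \<eta> \<circ> comult"

primrec conv_power :: "('i yalg \<Rightarrow> complex) \<Rightarrow> nat \<Rightarrow> 'i yalg \<Rightarrow> complex" where
  "conv_power \<xi> 0 = counit"
| "conv_power \<xi> (Suc l) = convolution \<xi> (conv_power \<xi> l)"

definition conv_log :: "('i yalg \<Rightarrow> complex) \<Rightarrow> 'i yalg \<Rightarrow> complex" where
  "conv_log \<eta> p =
     - suminf (\<lambda>l. 1 / of_nat (Suc l) * conv_power (\<lambda>q. counit q - \<eta> q) (Suc l) p)"

section \<open>The \<open>LS\<close>-transform\<close>

definition chi :: "('i ncpoly \<Rightarrow> complex) \<Rightarrow> 'i yalg \<Rightarrow> complex" where
  "chi \<mu> = yalg_hom id (R_transform \<mu>)"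

definition LS :: "('i ncpoly \<Rightarrow> complex) \<Rightarrow> 'i ncps" where
  "LS \<mu> w = (if 2 \<le> length w then conv_log (chi \<mu>) (Y w) else 0)"

text \<open>The case \<open>k = 1\<close>, with the one-letter alphabet \<^typ>\<open>unit\<close>, as a series in \<open>\<complex>[[z]]\<close>.\<close>

definition LS1 :: "(unit ncpoly \<Rightarrow> complex) \<Rightarrow> complex fps" where
  "LS1 \<mu> = Abs_fps (\<lambda>n. LS \<mu> (replicate n ()))"

text \<open>The series \<open>u(z\<^sub>i)\<close>.\<close>

definition in_variable :: "complex fps \<Rightarrow> 'i \<Rightarrow> 'i ncps" where
  "in_variable u i w = (if set w \<subseteq> {i} then fps_nth u (length w) else 0)"

section \<open>The defining properties of the above functionals and homomorphisms\<close>

lemma sum_keys_superset: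
  assumes "finite S" "Poly_Mapping.keys p \<subseteq> S" "\<And>k. h k 0 = 0"
  shows "(\<Sum>k\<in>Poly_Mapping.keys p. h k (Poly_Mapping.lookup p k)) =
    (\<Sum>k\<in>S. h k (Poly_Mapping.lookup p k))"
  using assms by (intro sum.mono_neutral_left) (auto simp: in_keys_iff)

lemma sum_keys_add:
  fixes p q :: "'k \<Rightarrow>\<^sub>0 'c::comm_monoid_add" and h :: "'k \<Rightarrow> 'c \<Rightarrow> 'd::comm_monoid_add"
  assumes "\<And>k. h k 0 = 0" "\<And>k c d. h k (c + d) = h k c + h k d"
  shows "(\<Sum>k\<in>Poly_Mapping.keys (p + q). h k (Poly_Mapping.lookup (p + q) k)) =
    (\<Sum>k\<in>Poly_Mapping.keys p. h k (Poly_Mapping.lookup p k)) +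
    (\<Sum>k\<in>Poly_Mapping.keys q. h k (Poly_Mapping.lookup q k))"
proof -
  let ?S = "Poly_Mapping.keys p \<union> Poly_Mapping.keys q"
  have sub: "Poly_Mapping.keys (p + q) \<subseteq> ?S" by (rule Poly_Mapping.keys_add)
  have "(\<Sum>k\<in>Poly_Mapping.keys (p + q). h k (Poly_Mapping.lookup (p + q) k)) =
    (\<Sum>k\<in>?S. h k (Poly_Mapping.lookup (p + q) k))"
    using sub assms(1) by (intro sum_keys_superset) auto
  also have "\<dots> = (\<Sum>k\<in>?S. h k (Poly_Mapping.lookup p k)) + (\<Sum>k\<in>?S. h k (Poly_Mapping.lookup q k))"
    by (simp add: lookup_add assms sum.distrib)
  also have "(\<Sum>k\<in>?S. h k (Poly_Mapping.lookup p k)) =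
      (\<Sum>k\<in>Poly_Mapping.keys p. h k (Poly_Mapping.lookup p k))"
    by (rule sum_keys_superset[symmetric]) (auto simp: assms)
  also have "(\<Sum>k\<in>?S. h k (Poly_Mapping.lookup q k)) =
      (\<Sum>k\<in>Poly_Mapping.keys q. h k (Poly_Mapping.lookup q k))"
    by (rule sum_keys_superset[symmetric]) (auto simp: assms)
  finally show ?thesis .
qed

lemma poly_mapping_sum_monomials:
  "(\<Sum>k\<in>Poly_Mapping.keys p. Poly_Mapping.single k (Poly_Mapping.lookup p k)) = p"
proof (rule poly_mapping_eqI)
  fix k
  show "Poly_Mapping.lookup (\<Sum>k\<in>Poly_Mapping.keys p. Poly_Mapping.single k (Poly_Mapping.lookup p k)) k =
    Poly_Mapping.lookup p k"
    by (cases "k \<in> Poly_Mapping.keys p")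
      (auto simp: lookup_sum lookup_single when_def in_keys_iff)
qed

lemma single_induct [case_names zero single add]:
  fixes p :: "'k \<Rightarrow>\<^sub>0 'c::comm_monoid_add"
  assumes "P 0" "\<And>k c. P (Poly_Mapping.single k c)" "\<And>p q. P p \<Longrightarrow> P q \<Longrightarrow> P (p + q)"
  shows "P p"
proof -
  have "P (\<Sum>k\<in>S. Poly_Mapping.single k (Poly_Mapping.lookup p k))" if "finite S" for S
    using that by (induction S) (auto intro: assms)
  from this[OF finite_keys[of p]] show ?thesis
    by (simp add: poly_mapping_sum_monomials)
qed

lemma distribution_add: "distribution \<phi> a (p + q) = distribution \<phi> a p + distribution \<phi> a q"
  unfolding distribution_def by (rule sum_keys_add) (simp_all add: distrib_right)

lemma distribution_single:
  "distribution \<phi> a (Poly_Mapping.single w c) = c * \<phi> (prod_list (map a w))"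
  by (simp add: distribution_def)

lemma distribution_word:
  "distribution \<phi> a (prod_list (map ncX w)) = \<phi> (prod_list (map a w))"
  by (simp add: prod_list_ncX distribution_single)

lemma distribution_scale: "distribution \<phi> a (Poly_Mapping.single 0 c * p) = c * distribution \<phi> a p"
  by (induction p rule: single_induct)
    (simp_all add: distribution_add distribution_single mult_single distrib_left,
      simp add: distribution_def)

lemma distribution_in_normalized_functionals:
  assumes "nc_probability_space sc \<phi>" "\<And>i. \<phi> (a i) = 1"
  shows "distribution \<phi> a \<in> normalized_functionals"
  using distribution_word[of \<phi> a "[]"] distribution_word[of \<phi> a "[i]" for i]
    nc_probability_space.functional_one[OF assms(1)] assms(2)
  by (auto simp: normalized_functionals_def distribution_add distribution_scale)

lemma ymon_eval_superset:
  assumes "finite S" "Poly_Mapping.keys m \<subseteq> S"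
  shows "ymon_eval g m = (\<Prod>v\<in>S. g (letters v) ^ Poly_Mapping.lookup m v)"
  unfolding ymon_eval_def using assms
  by (intro prod.mono_neutral_left) (auto simp: in_keys_iff)

lemma ymon_eval_add: "ymon_eval g (m + n) = ymon_eval g m * ymon_eval g n"
proof -
  let ?S = "Poly_Mapping.keys m \<union> Poly_Mapping.keys n"
  have "ymon_eval g (m + n) = (\<Prod>v\<in>?S. g (letters v) ^ Poly_Mapping.lookup (m + n) v)"
    using Poly_Mapping.keys_add[of m n] by (intro ymon_eval_superset) auto
  moreover have "ymon_eval g m = (\<Prod>v\<in>?S. g (letters v) ^ Poly_Mapping.lookup m v)"
    "ymon_eval g n = (\<Prod>v\<in>?S. g (letters v) ^ Poly_Mapping.lookup n v)"
    by (rule ymon_eval_superset; simp)+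
  ultimately show ?thesis
    by (simp add: lookup_add power_add prod.distrib)
qed

context
  fixes \<iota> :: "complex \<Rightarrow> 'b::comm_ring_1" and g :: "'i list \<Rightarrow> 'b"
  assumes \<iota>: "\<iota> 1 = 1" "\<And>c d. \<iota> (c + d) = \<iota> c + \<iota> d" "\<And>c d. \<iota> (c * d) = \<iota> c * \<iota> d"
begin

lemma scalar_zero: "\<iota> 0 = 0"
  using \<iota>(2)[of 0 0] by simp

lemma yalg_hom_add: "yalg_hom \<iota> g (p + q) = yalg_hom \<iota> g p + yalg_hom \<iota> g q"
  unfolding yalg_hom_def by (rule sum_keys_add) (simp_all add: \<iota> scalar_zero distrib_right)

lemma yalg_hom_single: "yalg_hom \<iota> g (Poly_Mapping.single m c) = \<iota> c * ymon_eval g m"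
  by (simp add: yalg_hom_def scalar_zero)

lemma yalg_hom_zero: "yalg_hom \<iota> g 0 = 0"
  by (simp add: yalg_hom_def)

lemma yalg_hom_scalar: "yalg_hom \<iota> g (Poly_Mapping.single 0 c) = \<iota> c"
  by (simp add: yalg_hom_single ymon_eval_def)

lemma yalg_hom_mult: "yalg_hom \<iota> g (p * q) = yalg_hom \<iota> g p * yalg_hom \<iota> g q"
proof (induction p rule: single_induct)
  case zero
  show ?case by (simp add: yalg_hom_zero)
next
  case (single m c)
  show ?case
  proof (induction q rule: single_induct)
    case zero
    show ?case by (simp add: yalg_hom_zero)
  next
    case (single n d)
    show ?case by (simp add: yalg_hom_single mult_single ymon_eval_add \<iota> ac_simps)
  next
    case (add p q)
    then show ?case by (simp only: distrib_left yalg_hom_add)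
  qed
next
  case (add p q)
  then show ?case by (simp only: distrib_right yalg_hom_add)
qed

lemma yalg_hom_one: "yalg_hom \<iota> g 1 = 1"
  using yalg_hom_scalar[of 1] by (simp add: \<iota>)

lemma yalg_hom_Y: "2 \<le> length w \<Longrightarrow> yalg_hom \<iota> g (Y w) = g w"
  by (simp add: Y_def yalg_hom_single ymon_eval_def Yword_inverse \<iota>)

end

lemma tensor_functional_tensor:
  assumes "\<And>p q. \<xi> (p + q) = \<xi> p + \<xi> q" "\<And>c p. \<xi> (Poly_Mapping.single 0 c * p) = c * \<xi> p"
    and "\<And>p q. \<eta> (p + q) = \<eta> p + \<eta> q" "\<And>c p. \<eta> (Poly_Mapping.single 0 c * p) = c * \<eta> p"
  shows "tensor_functional \<xi> \<eta> (tensor p q) = \<xi> p * \<eta> q"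
proof -
  let ?T = "tensor_functional \<xi> \<eta>"
  have expand: "f p = (\<Sum>m\<in>Poly_Mapping.keys p. Poly_Mapping.lookup p m * f (Poly_Mapping.single m 1))"
    if "\<And>p q. f (p + q) = f p + f q" "\<And>c p. f (Poly_Mapping.single 0 c * p) = c * f p"
    for f :: "'a yalg \<Rightarrow> complex" and p
  proof -
    have zero: "f 0 = 0" using that(1)[of 0 0] by simp
    have single: "f (Poly_Mapping.single m c) = c * f (Poly_Mapping.single m 1)" for m c
      using that(2)[of c "Poly_Mapping.single m 1"] by (simp add: mult_single)
    have sum: "f (\<Sum>m\<in>S. h m) = (\<Sum>m\<in>S. f (h m))" if "finite S" for S and h :: "'a ymon \<Rightarrow> _"
      using that by (induction S) (simp_all add: zero \<open>\<And>p q. f (p + q) = f p + f q\<close>)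
    have "f p = f (\<Sum>m\<in>Poly_Mapping.keys p. Poly_Mapping.single m (Poly_Mapping.lookup p m))"
      by (simp only: poly_mapping_sum_monomials)
    also have "\<dots> = (\<Sum>m\<in>Poly_Mapping.keys p. f (Poly_Mapping.single m (Poly_Mapping.lookup p m)))"
      by (rule sum) simp
    also have "\<dots> = (\<Sum>m\<in>Poly_Mapping.keys p. Poly_Mapping.lookup p m * f (Poly_Mapping.single m 1))"
      by (rule sum.cong[OF refl single])
    finally show ?thesis .
  qed
  have T_add: "?T (s + t) = ?T s + ?T t" for s t
    unfolding tensor_functional_def case_prod_beta prod.collapse
    by (rule sum_keys_add) (simp_all add: distrib_right)
  have T_sum: "?T (\<Sum>m\<in>S. h m) = (\<Sum>m\<in>S. ?T (h m))" if "finite S" for S and h :: "'a ymon \<Rightarrow> _"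
    using that by (induction S) (simp_all add: T_add, simp add: tensor_functional_def)
  have T_single: "?T (Poly_Mapping.single (m, n) c) =
      c * (\<xi> (Poly_Mapping.single m 1) * \<eta> (Poly_Mapping.single n 1))" for m n c
    by (simp add: tensor_functional_def)
  show ?thesis
    unfolding tensor_def expand[OF assms(1,2), of p] expand[OF assms(3,4), of q]
    by (simp add: T_sum T_single sum_product ac_simps)
qed

end

theory Submission
  imports Defs
begin

text \<open>Call a word mixed if it contains two different letters, and let \<open>f = R\<^sub>\<mu>\<close>. The three
  statements are equivalent because each of them says that \<open>f\<close> vanishes on mixed words: the
  first by Speicher's theorem on mixed free cumulants, the other two because the lowest mixed
  coefficients of \<open>LS\<^sub>\<mu>\<close> and of \<open>R\<^sub>\<mu>\<close> are the same.

  Freeness. An element of expectation \<open>0\<close> in the algebra generated by \<open>a\<^sub>i\<close> is a linear combination of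
  centered powers \<open>a\<^sub>i^k - \<phi>(a\<^sub>i^k)\<close>, so freeness concerns only the joint moments: expanding a
  product of centered powers in which neighbouring letters differ must give \<open>0\<close>
  (\<open>freely_independent_iff_free_moments\<close>). If \<open>f\<close> vanishes on mixed words, the expansion is an
  inclusion-exclusion sum: what remains are the non-crossing partitions without mixed blocks in
  which no run of equal letters is a union of blocks. There are none, since an innermost
  connection between two runs would enclose a run that cannot be connected to anything
  (\<open>monochromatic_NC_has_saturated_run\<close>). Conversely, the expansions determine all moments from
  those of the single \<open>a\<^sub>i\<close> by induction on the length (\<open>free_moments_unique\<close>). So a free family
  has the moments that belong to the cumulants \<open>f\<close> with the mixed ones replaced by \<open>0\<close>, and these
  moments determine their cumulants.

  The logarithm. The convolution powers of \<open>\<chi>\<^sub>\<mu>\<close> are again characters, and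
  \<open>(\<epsilon> - \<chi>\<^sub>\<mu>)\<^sup>l\<close> is the \<open>l\<close>-th iterated difference at \<open>0\<close> of the sequence \<open>j \<mapsto> \<chi>\<^sub>\<mu>\<^sup>j\<close>.
  Let \<open>w\<close> be a mixed word such that \<open>f\<close> vanishes on all shorter mixed words. In the sum over
  \<open>\<pi>\<close> that gives \<open>\<chi>\<^sub>\<mu>\<^sup>j\<^sup>+\<^sup>1(Y\<^sub>w)\<close> only the smallest and the largest partition contribute: as
  \<open>P\<^sub>\<pi>\<close> composed with the permutation of \<open>K(\<pi>)\<close> is the full cycle, a word whose letters are
  constant on the blocks of \<open>\<pi>\<close> and of \<open>K(\<pi>)\<close> is constant
  (\<open>mixed_block_or_kreweras_block\<close>). Hence \<open>\<chi>\<^sub>\<mu>\<^sup>j(Y\<^sub>w) = j f(w)\<close> is linear in \<open>j\<close>, its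
  iterated differences vanish from the second one on, and \<open>LS\<^sub>\<mu>(w) = f(w)\<close> (\<open>LS_mixed\<close>). By
  induction on the length, \<open>LS\<^sub>\<mu>\<close> vanishes on mixed words if and only if \<open>f\<close> does.

  Finally \<open>a\<^sub>i\<close> alone arises from the family by the substitution of letters \<open>() \<mapsto> i\<close>, with which
  all constructions commute. So the coefficient of \<open>LS\<^sub>\<mu>\<close> at \<open>i\<^sup>n\<close> is that of the transform of
  \<open>a\<^sub>i\<close>, whatever the dependence of the family.\<close>

section \<open>Non-crossing partitions of sets of positions\<close>

text \<open>Partitions of subsets of the positions make it possible to cut off an interval of positions
  without relabelling the rest.\<close>

definition NC_on :: "nat set \<Rightarrow> nat set set set" where
  "NC_on S = {\<pi>. partition_on S \<pi> \<and>
     \<not> (\<exists>A\<in>\<pi>. \<exists>B\<in>\<pi>. A \<noteq> B \<and>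
          (\<exists>a b c d. a < b \<and> b < c \<and> c < d \<and> a \<in> A \<and> c \<in> A \<and> b \<in> B \<and> d \<in> B))}"

lemma NC_eq_NC_on: "NC n = NC_on {..<n}"
  by (simp add: NC_def NC_on_def)

lemma NC_onI:
  assumes "partition_on S \<pi>"
    and "\<And>A B a b c d. A \<in> \<pi> \<Longrightarrow> B \<in> \<pi> \<Longrightarrow> a < b \<Longrightarrow> b < c \<Longrightarrow> c < d \<Longrightarrow>
           a \<in> A \<Longrightarrow> c \<in> A \<Longrightarrow> b \<in> B \<Longrightarrow> d \<in> B \<Longrightarrow> A = B"
  shows "\<pi> \<in> NC_on S"
  unfolding NC_on_def
proof (intro CollectI conjI notI assms(1))
  assume "\<exists>A\<in>\<pi>. \<exists>B\<in>\<pi>. A \<noteq> B \<and>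
    (\<exists>a b c d. a < b \<and> b < c \<and> c < d \<and> a \<in> A \<and> c \<in> A \<and> b \<in> B \<and> d \<in> B)"
  then show False using assms(2) by (elim bexE exE conjE) metis
qed

lemma NC_on_partition: "\<pi> \<in> NC_on S \<Longrightarrow> partition_on S \<pi>"
  by (simp add: NC_on_def)

lemma NC_on_noncrossing:
  assumes "\<pi> \<in> NC_on S" "A \<in> \<pi>" "B \<in> \<pi>" "a < b" "b < c" "c < d"
    "a \<in> A" "c \<in> A" "b \<in> B" "d \<in> B"
  shows "A = B"
proof (rule ccontr)
  assume "A \<noteq> B"
  then have "\<exists>A\<in>\<pi>. \<exists>B\<in>\<pi>. A \<noteq> B \<and>
    (\<exists>a b c d. a < b \<and> b < c \<and> c < d \<and> a \<in> A \<and> c \<in> A \<and> b \<in> B \<and> d \<in> B)"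
    using assms(2-) by (intro bexI[of _ A] bexI[of _ B] conjI exI[of _ a] exI[of _ b] exI[of _ c] exI[of _ d])
  with assms(1)[unfolded NC_on_def mem_Collect_eq] show False by (elim conjE notE)
qed

lemma partition_on_same_block:
  "partition_on S \<pi> \<Longrightarrow> A \<in> \<pi> \<Longrightarrow> B \<in> \<pi> \<Longrightarrow> x \<in> A \<Longrightarrow> x \<in> B \<Longrightarrow> A = B"
  by (meson disjoint_iff partition_onD2 disjointD)

lemma finite_NC_on: "finite S \<Longrightarrow> finite (NC_on S)"
  by (rule finite_subset[of _ "Pow (Pow S)"]) (auto simp: NC_on_def partition_on_def)

lemma finite_NC: "finite (NC n)"
  by (simp add: NC_eq_NC_on finite_NC_on)

lemma NC_onD_subset: "\<pi> \<in> NC_on S \<Longrightarrow> B \<in> \<pi> \<Longrightarrow> B \<subseteq> S"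
  by (auto simp: NC_on_def partition_on_def)

lemma finite_NC_on_member: "finite S \<Longrightarrow> \<pi> \<in> NC_on S \<Longrightarrow> finite \<pi>"
  using finite_elements NC_on_partition by blast

lemma finite_NC_member: "\<pi> \<in> NC n \<Longrightarrow> finite \<pi>"
  unfolding NC_eq_NC_on by (rule finite_NC_on_member[of "{..<n}"]) simp_all

lemma NC_block_nonempty: "\<pi> \<in> NC n \<Longrightarrow> B \<in> \<pi> \<Longrightarrow> B \<noteq> {}"
  by (metis NC_eq_NC_on NC_on_partition partition_onD3)

lemma one_in_NC: "n > 0 \<Longrightarrow> {{..<n}} \<in> NC n"
  unfolding NC_eq_NC_on by (rule NC_onI) (auto simp: partition_on_def)

lemma zero_in_NC: "(\<lambda>x. {x}) ` {..<n} \<in> NC n"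
  unfolding NC_eq_NC_on by (rule NC_onI) (auto simp: partition_on_def disjoint_def)

section \<open>The permutation of a partition\<close>

context
  fixes S :: "nat set" and \<pi> :: "nat set set"
  assumes S: "finite S" "partition_on S \<pi>"
begin

lemma block_perm_block:
  assumes "B \<in> \<pi>" "x \<in> B"
  shows "block_perm \<pi> x = (if \<exists>y\<in>B. x < y then Min {y\<in>B. x < y} else Min B)"
proof -
  have "(THE B. B \<in> \<pi> \<and> x \<in> B) = B"
    using assms partition_on_same_block[OF S(2)] by (intro the_equality) auto
  then show ?thesis using assms unfolding block_perm_def by (auto simp: Let_def)
qed

lemma block_perm_outside: "x \<notin> S \<Longrightarrow> block_perm \<pi> x = x"
  using partition_onD1[OF S(2)] by (auto simp: block_perm_def)

lemma finite_block: "B \<in> \<pi> \<Longrightarrow> finite B"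
  using S(1) partition_onD1[OF S(2)] by (metis finite_subset Union_upper)

lemma block_perm_next:
  assumes "B \<in> \<pi>" "x \<in> B" "z \<in> B" "x < z" "\<And>y. y \<in> B \<Longrightarrow> x < y \<Longrightarrow> z \<le> y"
  shows "block_perm \<pi> x = z"
proof -
  have "Min {y\<in>B. x < y} = z"
    using assms finite_block[OF assms(1)] by (intro Min_eqI) auto
  then show ?thesis using assms block_perm_block[OF assms(1,2)] by auto
qed

lemma block_perm_wrap:
  assumes "B \<in> \<pi>" "x \<in> B" "z \<in> B" "\<And>y. y \<in> B \<Longrightarrow> y \<le> x" "\<And>y. y \<in> B \<Longrightarrow> z \<le> y"
  shows "block_perm \<pi> x = z"
proof -
  have "Min B = z"
    using assms finite_block[OF assms(1)] by (intro Min_eqI) auto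
  moreover have "\<not> (\<exists>y\<in>B. x < y)" using assms(4) by (auto simp: not_less)
  ultimately show ?thesis using block_perm_block[OF assms(1,2)] by simp
qed

lemma block_perm_in_block:
  assumes "B \<in> \<pi>" "x \<in> B"
  shows "block_perm \<pi> x \<in> B"
proof (cases "\<exists>y\<in>B. x < y")
  case True
  then have "Min {y\<in>B. x < y} \<in> {y\<in>B. x < y}"
    using finite_block[OF assms(1)] by (intro Min_in) auto
  then show ?thesis using True block_perm_block[OF assms] by auto
next
  case False
  then show ?thesis using block_perm_block[OF assms] finite_block[OF assms(1)] assms(2)
    by (auto intro!: Min_in)
qed

lemma block_perm_predecessor:
  assumes "B \<in> \<pi>" "z \<in> B"
  shows "\<exists>x\<in>B. block_perm \<pi> x = z"
proof (cases "\<exists>y\<in>B. y < z")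
  case True
  have fin: "finite {y\<in>B. y < z}" using finite_block[OF assms(1)] by auto
  let ?x = "Max {y\<in>B. y < z}"
  have x: "?x \<in> {y\<in>B. y < z}" using fin True by (intro Max_in) auto
  have "z \<le> y" if "y \<in> B" "?x < y" for y
  proof (rule ccontr)
    assume "\<not> z \<le> y"
    then have "y \<le> ?x" using that fin by (intro Max_ge) auto
    with that show False by simp
  qed
  then have "block_perm \<pi> ?x = z" using x assms by (intro block_perm_next) auto
  with x show ?thesis by blast
next
  case False
  have fin: "finite B" using finite_block[OF assms(1)] .
  have M: "Max B \<in> B" using fin assms(2) by (intro Max_in) auto
  then have "block_perm \<pi> (Max B) = z"
    using False assms fin by (intro block_perm_wrap[of B]) (auto simp: not_less)
  with M show ?thesis by blast
qed

lemma bij_block_perm: "bij (block_perm \<pi>)"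
proof -
  let ?P = "block_perm \<pi>"
  have U: "S = \<Union>\<pi>" using S(2) by (rule partition_onD1)
  have img: "?P ` S = S"
  proof (intro equalityI subsetI)
    fix y assume "y \<in> ?P ` S"
    then show "y \<in> S" unfolding U using block_perm_in_block by blast
  next
    fix y assume "y \<in> S"
    then obtain B where B: "B \<in> \<pi>" "y \<in> B" unfolding U by blast
    from block_perm_predecessor[OF this] B show "y \<in> ?P ` S" unfolding U by blast
  qed
  then have "inj_on ?P S" using S(1) by (simp add: eq_card_imp_inj_on)
  with img have "bij_betw ?P S S" by (simp add: bij_betw_def)
  moreover have "bij_betw ?P (- S) (- S)"
    using block_perm_outside by (intro bij_betw_imageI inj_onI) auto
  ultimately have "bij_betw ?P (S \<union> - S) (S \<union> - S)"
    by (rule bij_betw_combine) simp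
  then show ?thesis by simp
qed

text \<open>The elements of a block form a single cycle, so an invariant set that meets a block contains it.\<close>

lemma block_subset_invariant:
  assumes "B \<in> \<pi>" "x \<in> B" "x \<in> T" and inv: "\<And>y. y \<in> T \<Longrightarrow> block_perm \<pi> y \<in> T"
  shows "B \<subseteq> T"
proof -
  have up: "y \<in> T" if "x0 \<in> T" "x0 \<in> B" "y \<in> B" "x0 \<le> y" for x0 y
    using that(3,4)
  proof (induction y rule: less_induct)
    case (less y)
    show ?case
    proof (cases "x0 = y")
      case False
      obtain p where p: "p \<in> B" "block_perm \<pi> p = y"
        using block_perm_predecessor[OF assms(1) less.prems(1)] by blast
      have ex: "\<exists>z\<in>B. p < z"
      proof (rule ccontr)
        assume c: "\<not> ?thesis"
        then have "y = Min B" using p block_perm_block[OF assms(1) p(1)] by auto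
        then have "y \<le> x0" using that(2) finite_block[OF assms(1)] by auto
        with False less.prems show False by auto
      qed
      have py: "y = Min {z\<in>B. p < z}" using ex p block_perm_block[OF assms(1) p(1)] by auto
      have "Min {z\<in>B. p < z} \<in> {z\<in>B. p < z}"
        using ex finite_block[OF assms(1)] by (intro Min_in) auto
      then have "p < y" using py by auto
      moreover have "x0 \<le> p"
      proof (rule ccontr)
        assume "\<not> x0 \<le> p"
        then have "y \<le> x0" unfolding py using that(2) finite_block[OF assms(1)] by (intro Min_le) auto
        with False less.prems show False by auto
      qed
      ultimately show ?thesis using less.IH[of p] p inv by metis
    qed (use that in simp)
  qed
  have fin: "finite B" "B \<noteq> {}" using finite_block[OF assms(1)] assms(2) by auto
  have "Max B \<in> T" using up[OF assms(3,2), of "Max B"] fin assms(2) by auto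
  then have "block_perm \<pi> (Max B) \<in> T" by (rule inv)
  also have "block_perm \<pi> (Max B) = Min B"
    using fin by (intro block_perm_wrap[OF assms(1)]) auto
  finally show ?thesis using up[of "Min B"] fin by auto
qed

end

text \<open>The blocks can be recovered as the cycles, which makes the Kreweras complement unique.\<close>

lemma block_perm_inject:
  assumes "finite S" "partition_on S \<pi>" "partition_on S \<sigma>" "block_perm \<pi> = block_perm \<sigma>"
  shows "\<pi> = \<sigma>"
proof -
  have sub: "\<exists>C\<in>\<tau>. B \<subseteq> C \<and> B \<noteq> {}"
    if \<rho>: "partition_on S \<rho>" and \<tau>: "partition_on S \<tau>"
      and eq: "block_perm \<rho> = block_perm \<tau>" and B: "B \<in> \<rho>" for \<rho> \<tau> B
  proof -
    obtain x where x: "x \<in> B" using \<rho> B by (metis partition_onD3 ex_in_conv)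
    then have "x \<in> S" using \<rho> B partition_onD1 by blast
    then obtain C where C: "C \<in> \<tau>" "x \<in> C" using \<tau> partition_onD1 by blast
    have "B \<subseteq> C"
      by (rule block_subset_invariant[OF assms(1) \<rho> B x C(2)])
        (simp add: eq block_perm_in_block[OF assms(1) \<tau> C(1)])
    with C x show ?thesis by auto
  qed
  have "B \<in> \<tau>" if h: "B \<in> \<rho>" "partition_on S \<rho>" "partition_on S \<tau>"
    "block_perm \<rho> = block_perm \<tau>" for B \<rho> \<tau>
  proof -
    obtain C where C: "C \<in> \<tau>" "B \<subseteq> C" "B \<noteq> {}" using sub[OF h(2-4,1)] by blast
    obtain D where D: "D \<in> \<rho>" "C \<subseteq> D" using sub[OF h(3,2) h(4)[symmetric] C(1)] by blast
    have "B = D" using partition_on_same_block[OF h(2,1) D(1)] C D by blast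
    with C D show ?thesis by auto
  qed
  with assms show ?thesis by (metis subsetI subset_antisym)
qed

section \<open>The Kreweras complement\<close>

text \<open>The blocks of \<open>K(\<pi>)\<close>: place a second copy of \<open>x\<close> between the positions \<open>x\<close> and \<open>x + 1\<close>; then
  \<open>x\<close> and \<open>y\<close> belong together if no block of \<open>\<pi>\<close> separates their copies, that is, if the interval
  \<open>{x<..y}\<close> (or \<open>{y<..x}\<close>) is a union of blocks. A position \<open>p\<close> lies in
  one of these intervals if and only if \<open>p \<le> x\<close> and \<open>p \<le> y\<close> differ; with this formula
  transitivity becomes a matter of propositional logic.\<close>

definition kreweras_rel :: "nat \<Rightarrow> nat set set \<Rightarrow> (nat \<times> nat) set" where
  "kreweras_rel n \<pi> = {(x, y). x < n \<and> y < n \<and>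
     (\<forall>B\<in>\<pi>. \<forall>p\<in>B. \<forall>q\<in>B. (p \<le> x \<longleftrightarrow> p \<le> y) \<longleftrightarrow> (q \<le> x \<longleftrightarrow> q \<le> y))}"

lemma equiv_kreweras_rel: "equiv {..<n} (kreweras_rel n \<pi>)"
proof (rule equivI)
  show "kreweras_rel n \<pi> \<subseteq> {..<n} \<times> {..<n}" by (auto simp: kreweras_rel_def)
  show "refl_on {..<n} (kreweras_rel n \<pi>)" by (auto simp: kreweras_rel_def refl_on_def)
  show "sym (kreweras_rel n \<pi>)"
    unfolding kreweras_rel_def by (rule symI) (simp only: mem_Collect_eq prod.case, blast)
  show "trans (kreweras_rel n \<pi>)"
  proof (rule transI)
    fix x y z assume xy: "(x, y) \<in> kreweras_rel n \<pi>" and yz: "(y, z) \<in> kreweras_rel n \<pi>"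
    have bool_rule: "(a \<longleftrightarrow> b) = (c \<longleftrightarrow> d) \<Longrightarrow> (b \<longleftrightarrow> e) = (d \<longleftrightarrow> f) \<Longrightarrow> (a \<longleftrightarrow> e) = (c \<longleftrightarrow> f)"
      for a b c d e f by (cases a; cases b; cases c; cases d; cases e; simp_all)
    have "(p \<le> x \<longleftrightarrow> p \<le> z) \<longleftrightarrow> (q \<le> x \<longleftrightarrow> q \<le> z)" if B: "B \<in> \<pi>" "p \<in> B" "q \<in> B" for B p q
    proof -
      note 1 = xy[unfolded kreweras_rel_def mem_Collect_eq prod.case, THEN conjunct2, THEN conjunct2, rule_format, OF B]
      note 2 = yz[unfolded kreweras_rel_def mem_Collect_eq prod.case, THEN conjunct2, THEN conjunct2, rule_format, OF B]
      show ?thesis by (rule bool_rule[OF 1 2])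
    qed
    moreover have "x < n" "z < n" using xy yz unfolding kreweras_rel_def by simp_all
    ultimately show "(x, z) \<in> kreweras_rel n \<pi>"
      unfolding kreweras_rel_def mem_Collect_eq prod.case by (intro conjI ballI)
  qed
qed

lemma kreweras_rel_less:
  assumes "x < y"
  shows "(x, y) \<in> kreweras_rel n \<pi> \<longleftrightarrow> y < n \<and>
    (\<forall>B\<in>\<pi>. \<forall>p\<in>B. \<forall>q\<in>B. x < p \<and> p \<le> y \<longrightarrow> x < q \<and> q \<le> y)"
proof -
  have 1: "(p \<le> x \<longleftrightarrow> p \<le> y) \<longleftrightarrow> \<not> (x < p \<and> p \<le> y)" for p
    using assms by auto
  have 2: "(A \<longleftrightarrow> B) \<longleftrightarrow> (\<not> A \<longleftrightarrow> \<not> B)" for A B by blast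
  have "(x, y) \<in> kreweras_rel n \<pi> \<longleftrightarrow> y < n \<and>
    (\<forall>B\<in>\<pi>. \<forall>p\<in>B. \<forall>q\<in>B. (x < p \<and> p \<le> y) \<longleftrightarrow> (x < q \<and> q \<le> y))"
    unfolding kreweras_rel_def mem_Collect_eq prod.case 1 2[symmetric] using assms by auto
  then show ?thesis by blast
qed


lemma kreweras_rel_lessD:
  assumes "(x, y) \<in> kreweras_rel n \<pi>" "x < y" "B \<in> \<pi>" "p \<in> B" "q \<in> B" "x < p" "p \<le> y"
  shows "x < q \<and> q \<le> y"
  using assms(1)[unfolded kreweras_rel_less[OF assms(2)]] assms(3-) by blast

lemma kreweras_rel_lessI:
  assumes "x < y" "y < n"
    and "\<And>B p q. B \<in> \<pi> \<Longrightarrow> p \<in> B \<Longrightarrow> q \<in> B \<Longrightarrow> x < p \<Longrightarrow> p \<le> y \<Longrightarrow> x < q \<and> q \<le> y"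
  shows "(x, y) \<in> kreweras_rel n \<pi>"
  unfolding kreweras_rel_less[OF assms(1)] using assms(2,3) by blast

lemma full_cycle:
  "block_perm {{..<n}} x = (if Suc x < n then Suc x else if x < n then 0 else x)"
proof -
  have P: "partition_on {..<n} {{..<n}}" if "x < n"
    using that by (intro partition_on_space) auto
  consider "Suc x < n" | "x < n" "\<not> Suc x < n" | "\<not> x < n" by linarith
  then show ?thesis
  proof cases
    case 1
    then have "block_perm {{..<n}} x = Suc x"
      by (intro block_perm_next[OF _ P, of "{..<n}"]) auto
    with 1 show ?thesis by simp
  next
    case 2
    then have "block_perm {{..<n}} x = 0"
      by (intro block_perm_wrap[OF _ P, of "{..<n}"]) auto
    with 2 show ?thesis by simp
  qed (simp add: block_perm_def)
qed

text \<open>A block with elements inside and outside of the interval spanned by a block \<open>B\<close> would cross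
  \<open>B\<close>. This is how the
  jumps of the Kreweras permutation are found: the interval from the least to the largest
  element of \<open>B\<close> is a union of blocks.\<close>

lemma NC_on_interval_to_Max:
  assumes \<pi>: "\<pi> \<in> NC_on S" "finite S" and B: "B \<in> \<pi>" "z \<in> B" "\<And>y. y \<in> B \<Longrightarrow> z \<le> y"
    and C: "C \<in> \<pi>" "p \<in> C" "q \<in> C" "z \<le> p" "p \<le> Max B"
  shows "z \<le> q \<and> q \<le> Max B"
proof (cases "C = B")
  case False
  have "finite B" using \<pi> B by (meson NC_onD_subset finite_subset)
  then have M: "Max B \<in> B" using B(2) by (intro Max_in) auto
  have ne: "p \<noteq> z" "p \<noteq> Max B"
    using False B(1,2) C(1,2) M(1) partition_on_same_block[OF NC_on_partition[OF \<pi>(1)]] by metis+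
  show ?thesis
  proof (rule ccontr)
    assume "\<not> ?thesis"
    then consider "q < z" | "Max B < q" by linarith
    then show False
    proof cases
      case 1
      from NC_on_noncrossing[OF \<pi>(1) C(1) B(1) 1 _ _ C(3,2) B(2) M(1)] ne C(4,5) False
      show False by simp
    next
      case 2
      from NC_on_noncrossing[OF \<pi>(1) B(1) C(1) _ _ 2 B(2) M(1) C(2,3)] ne C(4,5) False
      show False by simp
    qed
  qed
next
  case True
  have "finite B" using \<pi> B by (meson NC_onD_subset finite_subset)
  then show ?thesis using True C B by auto
qed

text \<open>The interval \<open>{b<..c}\<close> is the intersection of \<open>{a<..c}\<close> and \<open>{b<..d}\<close>, and an intersection of
  unions of blocks is a union of blocks.\<close>

lemma kreweras_rel_noncrossing:
  assumes "a < b" "b < c" "c < d" "(a, c) \<in> kreweras_rel n \<pi>" "(b, d) \<in> kreweras_rel n \<pi>"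
  shows "(b, c) \<in> kreweras_rel n \<pi>"
proof -
  have ac: "a < q \<and> q \<le> c" if "B \<in> \<pi>" "p \<in> B" "q \<in> B" "a < p" "p \<le> c" for B p q
    using kreweras_rel_lessD[OF assms(4) _ that] assms by simp
  have bd: "b < q \<and> q \<le> d" if "B \<in> \<pi>" "p \<in> B" "q \<in> B" "b < p" "p \<le> d" for B p q
    using kreweras_rel_lessD[OF assms(5) _ that] assms by simp
  have "b < q \<and> q \<le> c" if "B \<in> \<pi>" "p \<in> B" "q \<in> B" "b < p" "p \<le> c" for B p q
    using ac[OF that(1-3)] bd[OF that(1-3)] that assms by auto
  moreover have "c < n" using assms(4) unfolding kreweras_rel_def by blast
  ultimately show ?thesis using assms(2) by (intro kreweras_rel_lessI)
qed

text \<open>It has to be shown that \<open>P\<^sub>\<sigma>(x)\<close> is the cyclic predecessor of \<open>x + 1\<close> in its block \<open>B\<close> of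
  \<open>\<pi>\<close>. If \<open>x + 1\<close> is the least element of \<open>B\<close>, this predecessor is the largest element \<open>m\<close>
  of \<open>B\<close>, and \<open>{x<..m}\<close> is the shortest interval beginning at \<open>x + 1\<close> that is a union of
  blocks. Otherwise it is the element \<open>p\<close> of \<open>B\<close> preceding \<open>x + 1\<close>; then no interval beginning at
  \<open>x + 1\<close> is a union of blocks, and \<open>{p<..x}\<close> is the longest one that ends in \<open>x\<close>. If \<open>x\<close> is
  the last position, the role of \<open>x + 1\<close> is played by \<open>0\<close>.\<close>

lemma kreweras_rel_step:
  assumes \<pi>: "\<pi> \<in> NC n" and \<sigma>: "\<sigma> = {..<n} // kreweras_rel n \<pi>" and x: "x < n"
  shows "block_perm \<pi> (block_perm \<sigma> x) = block_perm {{..<n}} x"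
proof -
  note \<pi>' = \<pi>[unfolded NC_eq_NC_on]
  have P\<pi>: "partition_on {..<n} \<pi>" using \<pi>' by (rule NC_on_partition)
  have U: "\<Union>\<pi> = {..<n}" using partition_onD1[OF P\<pi>] by (rule sym)
  have P\<sigma>: "partition_on {..<n} \<sigma>"
    unfolding \<sigma> by (rule partition_on_quotient[OF equiv_kreweras_rel])
  let ?r = "kreweras_rel n \<pi>"
  note equiv = equiv_kreweras_rel[of n \<pi>]
  have rsym: "(u, v) \<in> ?r \<Longrightarrow> (v, u) \<in> ?r" for u v using equiv by (meson equivE symE)
  have rtrans: "(u, v) \<in> ?r \<Longrightarrow> (v, w) \<in> ?r \<Longrightarrow> (u, w) \<in> ?r" for u v w
    using equiv by (meson equivE transE)
  let ?C = "?r `` {x}"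
  have C: "?C \<in> \<sigma>" "x \<in> ?C"
    using x equiv_class_self[OF equiv] by (auto simp: \<sigma> intro: quotientI)
  have fin: "finite {..<n}" by simp
  show ?thesis
  proof (cases "Suc x < n")
    case True
    obtain B where B: "B \<in> \<pi>" "Suc x \<in> B" using True U by (metis UnionE lessThan_iff)
    have finB: "finite B" using finite_block[OF fin P\<pi> B(1)] .
    show ?thesis
    proof (cases "\<exists>p\<in>B. p \<le> x")
      case False
      let ?m = "Max B"
      have low: "Suc x \<le> y" if "y \<in> B" for y using False that by force
      have mB: "?m \<in> B" using finB B(2) by (intro Max_in) auto
      have xm: "x < ?m" using low[OF mB] by simp
      have rel: "(x, ?m) \<in> ?r"
      proof -
        have "?m < n" using mB B(1) U by (metis UnionI lessThan_iff)
        moreover have "x < q \<and> q \<le> ?m" if "D \<in> \<pi>" "p \<in> D" "q \<in> D" "x < p" "p \<le> ?m" for D p q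
          using NC_on_interval_to_Max[OF \<pi>' fin B low that(1-3) _ that(5)] that(4) by simp
        ultimately show ?thesis using xm by (intro kreweras_rel_lessI)
      qed
      have "block_perm \<sigma> x = ?m"
      proof (rule block_perm_next[OF fin P\<sigma> C])
        fix y assume y: "y \<in> ?C" "x < y"
        then have "(x, y) \<in> ?r" by simp
        from kreweras_rel_lessD[OF this y(2) B mB] y(2) show "?m \<le> y" by simp
      qed (use rel xm in auto)
      moreover have "block_perm \<pi> ?m = Suc x"
        using finB low by (intro block_perm_wrap[OF fin P\<pi> B(1) mB B(2)]) auto
      ultimately show ?thesis using True by (simp add: full_cycle)
    next
      case ex: True
      let ?p = "Max {p\<in>B. p \<le> x}"
      have "?p \<in> {p\<in>B. p \<le> x}" using ex finB by (intro Max_in) auto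
      then have p: "?p \<in> B" "?p \<le> x" by auto
      have pmax: "q \<le> ?p" if "q \<in> B" "q \<le> x" for q using that finB by (intro Max_ge) auto
      have rel: "(?p, x) \<in> ?r"
      proof (cases "?p = x")
        case False
        then have px: "?p < x" using p by simp
        have "?p < q \<and> q \<le> x" if D: "D \<in> \<pi>" "u \<in> D" "q \<in> D" "?p < u" "u \<le> x" for D u q
        proof (rule ccontr)
          assume neg: "\<not> ?thesis"
          have DB: "D \<noteq> B" using D(2,4) pmax[OF _ D(5)] by (metis leD)
          then have ne: "q \<noteq> ?p" "q \<noteq> Suc x"
            using D(1,3) B p(1) partition_on_same_block[OF P\<pi>] by metis+
          then consider "q < ?p" | "Suc x < q" using neg by linarith
          then show False
          proof cases
            case 1
            from NC_on_noncrossing[OF \<pi>' D(1) B(1) 1 D(4) _ D(3,2) p(1) B(2)] D(5) DB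
            show False by simp
          next
            case 2
            from NC_on_noncrossing[OF \<pi>' B(1) D(1) D(4) _ 2 p(1) B(2) D(2,3)] D(5) DB
            show False by simp
          qed
        qed
        with x px show ?thesis by (intro kreweras_rel_lessI)
      qed (use C(2) in simp)
      have "block_perm \<sigma> x = ?p"
      proof (rule block_perm_wrap[OF fin P\<sigma> C])
        show "?p \<in> ?C" using rel rsym by auto
        fix y assume "y \<in> ?C"
        then have y: "(x, y) \<in> ?r" by simp
        show "y \<le> x"
        proof (rule ccontr)
          assume "\<not> y \<le> x"
          then have "x < y" by simp
          from kreweras_rel_lessD[OF y this B p(1)] p this show False by simp
        qed
        show "?p \<le> y"
        proof (rule ccontr)
          assume c: "\<not> ?p \<le> y"
          then have "y < x" using p by simp
          from kreweras_rel_lessD[OF rsym[OF y] this B(1) p(1) B(2)] p c show False by simp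
        qed
      qed
      moreover have "block_perm \<pi> ?p = Suc x"
      proof (rule block_perm_next[OF fin P\<pi> B(1) p(1) B(2)])
        show "?p < Suc x" using p by simp
        show "Suc x \<le> y" if "y \<in> B" "?p < y" for y using pmax[OF that(1)] that(2) by linarith
      qed
      ultimately show ?thesis using True by (simp add: full_cycle)
    qed
  next
    case False
    then have xn: "n = Suc x" using x by simp
    obtain B where B: "B \<in> \<pi>" "0 \<in> B" using xn U by (metis UnionE lessThan_iff zero_less_Suc)
    have finB: "finite B" using finite_block[OF fin P\<pi> B(1)] .
    let ?m = "Max B"
    have mB: "?m \<in> B" using finB B(2) by (intro Max_in) auto
    then have mx: "?m \<le> x" using B(1) U xn by (metis UnionI lessThan_iff less_Suc_eq_le)
    have key: "q \<le> ?m" if "D \<in> \<pi>" "p \<in> D" "q \<in> D" "p \<le> ?m" for D p q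
      using NC_on_interval_to_Max[OF \<pi>' fin B _ that(1-3) _ that(4)] by simp
    have le: "q \<le> x" if "D \<in> \<pi>" "q \<in> D" for D q
      using that U xn by (metis UnionI lessThan_iff less_Suc_eq_le)
    have rel: "(x, ?m) \<in> ?r"
    proof -
      have "(p \<le> x \<longleftrightarrow> p \<le> ?m) \<longleftrightarrow> (q \<le> x \<longleftrightarrow> q \<le> ?m)" if "D \<in> \<pi>" "p \<in> D" "q \<in> D" for D p q
        using key[OF that] key[OF that(1,3,2)] le[OF that(1,2)] le[OF that(1,3)] by blast
      moreover have "?m < n" using mx x by simp
      ultimately show ?thesis
        unfolding kreweras_rel_def mem_Collect_eq prod.case using x by (intro conjI ballI)
    qed
    have "block_perm \<sigma> x = ?m"
    proof (rule block_perm_wrap[OF fin P\<sigma> C])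
      show "?m \<in> ?C" using rel by simp
      fix y assume "y \<in> ?C"
      then have y: "(x, y) \<in> ?r" by simp
      then have "y < n" unfolding kreweras_rel_def by blast
      then show "y \<le> x" using xn by simp
      show "?m \<le> y"
      proof (rule ccontr)
        assume c: "\<not> ?m \<le> y"
        then have "y < x" using mx by simp
        from kreweras_rel_lessD[OF rsym[OF y] this B(1) mB B(2)] mx c show False by simp
      qed
    qed
    moreover have "block_perm \<pi> ?m = 0"
      using finB by (intro block_perm_wrap[OF fin P\<pi> B(1) mB B(2)]) auto
    ultimately show ?thesis using False x by (simp add: full_cycle)
  qed
qed

lemma kreweras_NC: "\<pi> \<in> NC n \<Longrightarrow> kreweras n \<pi> \<in> NC n" (is "_ \<Longrightarrow> ?A")
  and block_perm_kreweras: "\<pi> \<in> NC n \<Longrightarrow>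
    block_perm \<pi> (block_perm (kreweras n \<pi>) x) = block_perm {{..<n}} x" (is "_ \<Longrightarrow> ?B")
proof -
  assume \<pi>: "\<pi> \<in> NC n"
  let ?\<sigma> = "{..<n} // kreweras_rel n \<pi>"
  have P\<pi>: "partition_on {..<n} \<pi>" using \<pi> unfolding NC_eq_NC_on by (rule NC_on_partition)
  have P: "partition_on {..<n} ?\<sigma>" by (rule partition_on_quotient[OF equiv_kreweras_rel])
  note bij = bij_block_perm[OF finite_lessThan P\<pi>]
  have NC: "?\<sigma> \<in> NC n"
    unfolding NC_eq_NC_on
  proof (rule NC_onI[OF P])
    fix A B a b c d
    assume h: "A \<in> ?\<sigma>" "B \<in> ?\<sigma>" "a < b" "b < c" "c < d" "a \<in> A" "c \<in> A" "b \<in> B" "d \<in> B"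
    have "(a, c) \<in> kreweras_rel n \<pi>" "(b, d) \<in> kreweras_rel n \<pi>"
      using quotient_eq_iff[OF equiv_kreweras_rel] h by metis+
    then have "(b, c) \<in> kreweras_rel n \<pi>" using kreweras_rel_noncrossing h by blast
    then show "A = B" using quotient_eq_iff[OF equiv_kreweras_rel h(1,2,7,8)]
      equiv_kreweras_rel by (metis equivE symE)
  qed
  have step: "block_perm \<pi> (block_perm ?\<sigma> x) = block_perm {{..<n}} x" for x
  proof (cases "x < n")
    case False
    then show ?thesis
      using block_perm_outside[OF finite_lessThan P\<pi>] block_perm_outside[OF finite_lessThan P]
      by (simp add: full_cycle)
  qed (rule kreweras_rel_step[OF \<pi> refl])
  have eq: "block_perm ?\<sigma> = inv (block_perm \<pi>) \<circ> block_perm {{..<n}}"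
    using bij by (auto simp: fun_eq_iff bij_is_inj simp flip: step)
  have K: "kreweras n \<pi> = ?\<sigma>"
    unfolding kreweras_def
  proof (rule the_equality)
    fix \<sigma> assume \<sigma>: "\<sigma> \<in> NC n \<and> block_perm \<sigma> = inv (block_perm \<pi>) \<circ> block_perm {{..<n}}"
    then have "partition_on {..<n} \<sigma>" unfolding NC_eq_NC_on by (blast dest: NC_on_partition)
    then show "\<sigma> = ?\<sigma>" using P \<sigma> eq by (intro block_perm_inject[of "{..<n}"]) auto
  qed (use NC eq in simp)
  show ?A ?B using NC step by (simp_all add: K)
qed

section \<open>The smallest and the largest partition\<close>

lemma block_perm_zero: "block_perm ((\<lambda>x. {x}) ` {..<n}) = id"
proof
  fix x
  have P: "partition_on {..<n} ((\<lambda>x. {x}) ` {..<n})" by (rule partition_on_singletons)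
  show "block_perm ((\<lambda>x. {x}) ` {..<n}) x = id x"
  proof (cases "x < n")
    case True
    then show ?thesis using block_perm_wrap[OF _ P, of "{x}" x x] by auto
  next
    case False
    then show ?thesis using block_perm_outside[OF _ P] by simp
  qed
qed

lemma kreweras_zero: "n > 0 \<Longrightarrow> kreweras n ((\<lambda>x. {x}) ` {..<n}) = {{..<n}}"
  using block_perm_kreweras[OF zero_in_NC, of n] kreweras_NC[OF zero_in_NC, of n] one_in_NC[of n]
  unfolding NC_eq_NC_on block_perm_zero
  by (intro block_perm_inject[of "{..<n}"]) (auto dest: NC_on_partition)

lemma kreweras_eq_one:
  assumes "\<pi> \<in> NC n" "kreweras n \<pi> = {{..<n}}"
  shows "\<pi> = (\<lambda>x. {x}) ` {..<n}"
proof (cases "n = 0")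
  case True
  with assms show ?thesis by (simp add: NC_eq_NC_on NC_on_def partition_on_empty)
next
  case False
  then have bij: "bij (block_perm {{..<n}})"
    by (intro bij_block_perm[of "{..<n}"] partition_on_space) auto
  have "block_perm \<pi> y = y" for y
    using block_perm_kreweras[OF assms(1)] bij unfolding assms(2) by (metis bij_pointE)
  then have "block_perm \<pi> = block_perm ((\<lambda>x. {x}) ` {..<n})" by (auto simp: block_perm_zero)
  then show ?thesis using assms(1) zero_in_NC[of n] unfolding NC_eq_NC_on
    by (intro block_perm_inject[of "{..<n}"]) (auto dest: NC_on_partition)
qed

lemma kreweras_one:
  assumes "n > 0" shows "kreweras n {{..<n}} = (\<lambda>x. {x}) ` {..<n}"
proof -
  have bij: "bij (block_perm {{..<n}})"
    using assms by (intro bij_block_perm[of "{..<n}"] partition_on_space) auto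
  have "block_perm (kreweras n {{..<n}}) = block_perm ((\<lambda>x. {x}) ` {..<n})"
    using block_perm_kreweras[OF one_in_NC[OF assms]] bij_is_inj[OF bij]
    by (auto simp: block_perm_zero fun_eq_iff dest: injD)
  then show ?thesis using kreweras_NC[OF one_in_NC[OF assms]] zero_in_NC[of n] unfolding NC_eq_NC_on
    by (intro block_perm_inject[of "{..<n}"]) (auto dest: NC_on_partition)
qed

lemma NC_proper_block:
  assumes "\<pi> \<in> NC n" "\<pi> \<noteq> {{..<n}}" "B \<in> \<pi>"
  shows "B \<subset> {..<n}"
proof -
  have P: "partition_on {..<n} \<pi>" using assms(1) unfolding NC_eq_NC_on by (rule NC_on_partition)
  have "B \<noteq> {..<n}"
  proof
    assume B: "B = {..<n}"
    have "C = B" if "C \<in> \<pi>" for C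
    proof -
      obtain x where "x \<in> C" using \<open>C \<in> \<pi>\<close> P by (metis partition_onD3 ex_in_conv)
      moreover have "x \<in> B" using calculation \<open>C \<in> \<pi>\<close> partition_onD1[OF P] unfolding B by blast
      ultimately show ?thesis using partition_on_same_block[OF P \<open>C \<in> \<pi>\<close> assms(3)] by blast
    qed
    with assms B show False by blast
  qed
  then show ?thesis using assms(3) partition_onD1[OF P] by blast
qed

section \<open>Moments and cumulants\<close>

definition moment :: "'i ncps \<Rightarrow> 'i list \<Rightarrow> complex" where
  "moment f w = (\<Sum>\<pi>\<in>NC (length w). Cf_part w \<pi> f)"

lemma nths_all_positions: "nths w {..<length w} = w"
  by (rule nths_all) simp

lemma Cf_part_one: "Cf_part w {{..<length w}} f = f w"
  by (simp add: Cf_part_def nths_all_positions)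

lemma length_nths_card: "B \<subseteq> {..<length w} \<Longrightarrow> length (nths w B) = card B"
  by (auto simp: length_nths intro!: arg_cong[where f = card])

lemma NC_subset: "\<pi> \<in> NC n \<Longrightarrow> B \<in> \<pi> \<Longrightarrow> B \<subseteq> {..<n}"
  unfolding NC_eq_NC_on by (rule NC_onD_subset)

lemma length_nths_proper_block:
  assumes "\<pi> \<in> NC (length w)" "\<pi> \<noteq> {{..<length w}}" "B \<in> \<pi>"
  shows "length (nths w B) < length w" "nths w B \<noteq> []"
proof -
  have B: "B \<subset> {..<length w}" by (rule NC_proper_block[OF assms])
  have len: "length (nths w B) = card B" using B by (intro length_nths_card) auto
  show "length (nths w B) < length w" using psubset_card_mono[OF finite_lessThan B] len by simp
  have "card B \<noteq> 0"
    using B NC_block_nonempty[OF assms(1,3)] finite_subset[of B "{..<length w}"] by auto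
  with len show "nths w B \<noteq> []" by (metis list.size(3))
qed

lemma moment_split:
  assumes "w \<noteq> []"
  shows "moment f w = f w + (\<Sum>\<pi>\<in>NC (length w) - {{{..<length w}}}. Cf_part w \<pi> f)"
  unfolding moment_def using assms one_in_NC[of "length w"]
  by (simp add: sum.remove[OF finite_NC] Cf_part_one)

lemma moment_Nil: "moment f [] = 1"
proof -
  have "NC 0 = {{}}" unfolding NC_def lessThan_0 partition_on_empty by blast
  then show ?thesis by (simp add: moment_def Cf_part_def)
qed

lemma Cf_part_cong_shorter:
  assumes "\<pi> \<in> NC (length w)" "\<pi> \<noteq> {{..<length w}}"
    and "\<And>v. v \<noteq> [] \<Longrightarrow> length v < length w \<Longrightarrow> f v = g v"
  shows "Cf_part w \<pi> f = Cf_part w \<pi> g"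
  unfolding Cf_part_def using length_nths_proper_block[OF assms(1,2)] assms(3)
  by (intro prod.cong) auto

text \<open>The moment of \<open>w\<close> is \<open>f w\<close> plus a polynomial in the values of \<open>f\<close> on shorter words, so \<open>f\<close> can be
  recovered by induction on the length.\<close>

lemma moment_inject:
  assumes "f [] = g []" "\<And>w. w \<noteq> [] \<Longrightarrow> moment f w = moment g w"
  shows "f = g"
proof
  fix w show "f w = g w"
  proof (induction w rule: length_induct)
    case (1 w)
    show ?case
    proof (cases "w = []")
      case False
      have "(\<Sum>\<pi>\<in>NC (length w) - {{{..<length w}}}. Cf_part w \<pi> f) =
          (\<Sum>\<pi>\<in>NC (length w) - {{{..<length w}}}. Cf_part w \<pi> g)"
        using 1 by (intro sum.cong refl Cf_part_cong_shorter) auto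
      then show ?thesis using assms(2)[OF False] moment_split[OF False] by simp
    qed (use assms in simp)
  qed
qed

text \<open>The inverse of \<open>moment\<close>. The recursion ends because the blocks of a partition other than \<open>1\<^sub>n\<close>
  are proper subsets of the positions.\<close>

function cumulant :: "('i list \<Rightarrow> complex) \<Rightarrow> 'i list \<Rightarrow> complex" where
  "cumulant m w = (if w = [] then 0 else
     m w - (\<Sum>\<pi>\<in>NC (length w) - {{{..<length w}}}. \<Prod>B\<in>\<pi>. cumulant m (nths w B)))"
  by auto
termination
  by (relation "measure (\<lambda>(m, w). length w)") (auto intro: length_nths_proper_block)

declare cumulant.simps [simp del]

lemma moment_cumulant: "w \<noteq> [] \<Longrightarrow> moment (cumulant m) w = m w"
  by (subst moment_split, assumption, subst cumulant.simps) (simp add: Cf_part_def)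

lemma R_transform_eq_cumulant: "R_transform \<mu> = cumulant (\<lambda>w. \<mu> (prod_list (map ncX w)))"
  unfolding R_transform_def
proof (rule the_equality)
  show "cumulant (\<lambda>w. \<mu> (prod_list (map ncX w))) [] = 0 \<and>
    (\<forall>w. w \<noteq> [] \<longrightarrow> \<mu> (prod_list (map ncX w)) =
      (\<Sum>\<pi>\<in>NC (length w). Cf_part w \<pi> (cumulant (\<lambda>w. \<mu> (prod_list (map ncX w))))))"
    unfolding moment_def[symmetric] by (simp add: moment_cumulant cumulant.simps)
next
  fix f :: "'a ncps"
  assume "f [] = 0 \<and> (\<forall>w. w \<noteq> [] \<longrightarrow> \<mu> (prod_list (map ncX w)) =
      (\<Sum>\<pi>\<in>NC (length w). Cf_part w \<pi> f))"
  then show "f = cumulant (\<lambda>w. \<mu> (prod_list (map ncX w)))"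
    unfolding moment_def[symmetric] by (intro moment_inject) (auto simp: moment_cumulant cumulant.simps)
qed

lemma moment_map: "moment f (map h w) = moment (\<lambda>v. f (map h v)) w"
  by (simp add: moment_def Cf_part_def nths_map)

lemma cumulant_map: "cumulant m (map h w) = cumulant (\<lambda>v. m (map h v)) w"
proof -
  have "(\<lambda>w. cumulant m (map h w)) = cumulant (\<lambda>v. m (map h v))"
  proof (rule moment_inject)
    fix w :: "'b list" assume "w \<noteq> []"
    then show "moment (\<lambda>w. cumulant m (map h w)) w = moment (cumulant (\<lambda>v. m (map h v))) w"
      by (simp add: moment_map[symmetric] moment_cumulant)
  qed (simp add: cumulant.simps)
  then show ?thesis by metis
qed

section \<open>Relabelling positions\<close>

lemma NC_on_image:
  assumes "\<pi> \<in> NC_on S" "strict_mono_on S r"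
  shows "(`) r ` \<pi> \<in> NC_on (r ` S)"
proof (rule NC_onI)
  have inj: "inj_on r S" using assms(2) by (rule strict_mono_on_imp_inj_on)
  show "partition_on (r ` S) ((`) r ` \<pi>)"
  proof -
    have "(`) r ` \<pi> - {{}} = (`) r ` \<pi>"
      using partition_onD3[OF NC_on_partition[OF assms(1)]] by auto
    with partition_on_inj_image[OF NC_on_partition[OF assms(1)] inj] show ?thesis by (simp only:)
  qed
  fix A B a b c d
  assume A: "A \<in> (`) r ` \<pi>" and B: "B \<in> (`) r ` \<pi>" and less: "a < b" "b < c" "c < d"
    and el: "a \<in> A" "c \<in> A" "b \<in> B" "d \<in> B"
  obtain A' where A': "A = r ` A'" "A' \<in> \<pi>" using A by blast
  obtain B' where B': "B = r ` B'" "B' \<in> \<pi>" using B by blast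
  obtain a' where a': "a = r a'" "a' \<in> A'" using el A' by blast
  obtain c' where c': "c = r c'" "c' \<in> A'" using el A' by blast
  obtain b' where b': "b = r b'" "b' \<in> B'" using el B' by blast
  obtain d' where d': "d = r d'" "d' \<in> B'" using el B' by blast
  have S: "a' \<in> S" "b' \<in> S" "c' \<in> S" "d' \<in> S"
    using NC_onD_subset[OF assms(1)] A' B' a' b' c' d' by blast+
  have "a' < b'" "b' < c'" "c' < d'"
    using less strict_mono_on_less[OF assms(2)] S a' b' c' d' by simp_all
  then have "A' = B'" using NC_on_noncrossing[OF assms(1) A'(2) B'(2)] a' b' c' d' by blast
  then show "A = B" by (simp add: A' B')
qed

lemma bij_betw_NC_on_image:
  assumes "strict_mono_on S r"
  shows "bij_betw ((`) ((`) r)) (NC_on S) (NC_on (r ` S))"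
proof -
  let ?s = "inv_into S r"
  have inj: "inj_on r S" using assms by (rule strict_mono_on_imp_inj_on)
  have s: "strict_mono_on (r ` S) ?s"
    by (rule strict_mono_onI)
      (auto simp: inv_into_f_f[OF inj] strict_mono_on_less[OF assms])
  have sr: "?s ` r ` A = A" if "A \<subseteq> S" for A
    using that inj by (simp add: inv_into_image_cancel)
  have rs: "r ` ?s ` A = A" if "A \<subseteq> r ` S" for A
    using that by (simp add: image_inv_into_cancel[OF refl])
  have S: "?s ` r ` S = S" using sr by blast
  show ?thesis
  proof (rule bij_betw_byWitness[where f' = "(`) ((`) ?s)"])
    show "\<forall>\<pi>\<in>NC_on S. (`) ?s ` (`) r ` \<pi> = \<pi>"
    proof
      fix \<pi> assume \<pi>: "\<pi> \<in> NC_on S"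
      have "?s ` r ` A = A" if "A \<in> \<pi>" for A using sr[OF NC_onD_subset[OF \<pi> that]] .
      then show "(`) ?s ` (`) r ` \<pi> = \<pi>" by (subst image_image) simp
    qed
    show "\<forall>\<pi>\<in>NC_on (r ` S). (`) r ` (`) ?s ` \<pi> = \<pi>"
    proof
      fix \<pi> assume \<pi>: "\<pi> \<in> NC_on (r ` S)"
      have "r ` ?s ` A = A" if "A \<in> \<pi>" for A using rs[OF NC_onD_subset[OF \<pi> that]] .
      then show "(`) r ` (`) ?s ` \<pi> = \<pi>" by (subst image_image) simp
    qed
    show "(`) ((`) r) ` NC_on S \<subseteq> NC_on (r ` S)" using NC_on_image[OF _ assms] by blast
    show "(`) ((`) ?s) ` NC_on (r ` S) \<subseteq> NC_on S" using NC_on_image[OF _ s] S by fastforce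
  qed
qed

lemma sum_prod_NC_on_image:
  assumes "strict_mono_on S r"
  shows "(\<Sum>\<pi>\<in>NC_on (r ` S). \<Prod>B\<in>\<pi>. g B) = (\<Sum>\<pi>\<in>NC_on S. \<Prod>B\<in>\<pi>. g (r ` B))"
proof -
  have inj: "inj_on r S" using assms by (rule strict_mono_on_imp_inj_on)
  have "(\<Sum>\<pi>\<in>NC_on (r ` S). \<Prod>B\<in>\<pi>. g B) = (\<Sum>\<pi>\<in>NC_on S. \<Prod>B\<in>(`) r ` \<pi>. g B)"
    by (rule sum.reindex_bij_betw[OF bij_betw_NC_on_image[OF assms], symmetric])
  also have "\<dots> = (\<Sum>\<pi>\<in>NC_on S. \<Prod>B\<in>\<pi>. g (r ` B))"
  proof (rule sum.cong[OF refl])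
    fix \<pi> assume "\<pi> \<in> NC_on S"
    then have "\<pi> \<subseteq> Pow S" using NC_onD_subset by blast
    then have "inj_on ((`) r) \<pi>" using inj by (meson inj_on_image_Pow inj_on_subset)
    then show "(\<Prod>B\<in>(`) r ` \<pi>. g B) = (\<Prod>B\<in>\<pi>. g (r ` B))" by (simp add: prod.reindex)
  qed
  finally show ?thesis .
qed

text \<open>The moment of a subword can be computed with partitions of the positions that the
  subword occupies in the whole word: the relabelling sends each position to its rank.\<close>

lemma moment_nths:
  assumes "S \<subseteq> {..<length w}"
  shows "moment f (nths w S) = (\<Sum>\<pi>\<in>NC_on S. \<Prod>B\<in>\<pi>. f (nths w B))"
proof -
  let ?r = "\<lambda>i. card {i'\<in>S. i' < i}"
  have fin: "finite S" using assms finite_subset by blast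
  have mono: "strict_mono_on S ?r"
  proof (rule strict_mono_onI)
    fix i j assume "i \<in> S" "j \<in> S" "i < j"
    then show "?r i < ?r j" using fin by (intro psubset_card_mono) auto
  qed
  have inj: "inj_on ?r S" using mono by (rule strict_mono_on_imp_inj_on)
  have "?r i < card S" if "i \<in> S" for i using that fin by (intro psubset_card_mono) auto
  then have "?r ` S \<subseteq> {..<card S}" by auto
  then have img: "?r ` S = {..<card S}"
    using card_image[OF inj] by (intro card_subset_eq) auto
  have nn: "nths (nths w S) (?r ` B) = nths w B" if "B \<subseteq> S" for B
  proof -
    have "{i \<in> S. \<exists>j\<in>?r ` B. card {i' \<in> S. i' < i} = j} = B"
      using that inj by (auto dest: inj_onD)
    then show ?thesis by (simp add: nths_nths)
  qed
  have "moment f (nths w S) = (\<Sum>\<pi>\<in>NC_on (?r ` S). \<Prod>B\<in>\<pi>. f (nths (nths w S) B))"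
    by (simp add: moment_def Cf_part_def NC_eq_NC_on img length_nths_card[OF assms])
  also have "\<dots> = (\<Sum>\<pi>\<in>NC_on S. \<Prod>B\<in>\<pi>. f (nths (nths w S) (?r ` B)))"
    by (rule sum_prod_NC_on_image[OF mono])
  also have "\<dots> = (\<Sum>\<pi>\<in>NC_on S. \<Prod>B\<in>\<pi>. f (nths w B))"
    using nn NC_onD_subset by (intro sum.cong prod.cong refl) (metis (no_types, lifting))
  finally show ?thesis .
qed

section \<open>Inclusion-exclusion over unions of blocks\<close>

definition saturated :: "nat set \<Rightarrow> nat set set \<Rightarrow> bool" where
  "saturated I \<pi> \<longleftrightarrow> (\<forall>B\<in>\<pi>. B \<subseteq> I \<or> B \<inter> I = {})"

lemma NC_on_Un:
  assumes \<pi>: "\<pi> \<in> NC_on I" "\<rho> \<in> NC_on (S - I)" and I: "I \<subseteq> S"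
    and convex: "\<And>x y z. x \<in> I \<Longrightarrow> z \<in> I \<Longrightarrow> y \<in> S \<Longrightarrow> x < y \<Longrightarrow> y < z \<Longrightarrow> y \<in> I"
  shows "\<pi> \<union> \<rho> \<in> NC_on S"
proof (rule NC_onI)
  have "disjoint (\<pi> \<union> \<rho>)"
    using NC_on_partition[OF \<pi>(1)] NC_on_partition[OF \<pi>(2)]
    by (intro disjoint_union) (auto simp: partition_on_def)
  then show "partition_on S (\<pi> \<union> \<rho>)"
    using NC_on_partition[OF \<pi>(1)] NC_on_partition[OF \<pi>(2)] I
    by (auto simp: partition_on_def)
  fix A B a b c d
  assume A: "A \<in> \<pi> \<union> \<rho>" and B: "B \<in> \<pi> \<union> \<rho>" and less: "a < b" "b < c" "c < d"
    and el: "a \<in> A" "c \<in> A" "b \<in> B" "d \<in> B"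
  have sub: "C \<in> \<pi> \<Longrightarrow> C \<subseteq> I" "C \<in> \<rho> \<Longrightarrow> C \<subseteq> S - I" for C
    using NC_onD_subset \<pi> by blast+
  consider "A \<in> \<pi>" "B \<in> \<pi>" | "A \<in> \<rho>" "B \<in> \<rho>" | "A \<in> \<pi>" "B \<in> \<rho>" | "A \<in> \<rho>" "B \<in> \<pi>"
    using A B by blast
  then show "A = B"
  proof cases
    case 1
    then show ?thesis using NC_on_noncrossing[OF \<pi>(1) 1 less] el by blast
  next
    case 2
    then show ?thesis using NC_on_noncrossing[OF \<pi>(2) 2 less] el by blast
  next
    case 3
    then have "a \<in> I" "c \<in> I" "b \<in> S - I" using sub el by blast+
    with convex[of a c b] less show ?thesis by blast
  next
    case 4
    then have "b \<in> I" "d \<in> I" "c \<in> S - I" using sub el by blast+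
    with convex[of b d c] less show ?thesis by blast
  qed
qed

lemma NC_on_restrict:
  assumes "\<pi> \<in> NC_on S" "saturated I \<pi>" "I \<subseteq> S"
  shows "{B\<in>\<pi>. B \<subseteq> I} \<in> NC_on I"
proof (rule NC_onI)
  show "partition_on I {B\<in>\<pi>. B \<subseteq> I}"
  proof (rule partition_onI)
    show "\<Union>{B\<in>\<pi>. B \<subseteq> I} = I"
    proof (intro equalityI subsetI)
      fix x assume x: "x \<in> I"
      have "x \<in> \<Union>\<pi>" using x assms(3) partition_onD1[OF NC_on_partition[OF assms(1)]] by blast
      then obtain B where B: "B \<in> \<pi>" "x \<in> B" by blast
      with assms(2)[unfolded saturated_def, rule_format, OF B(1)] x
      show "x \<in> \<Union>{B\<in>\<pi>. B \<subseteq> I}" by blast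
    qed blast
  next
    fix A B assume "A \<in> {B\<in>\<pi>. B \<subseteq> I}" "B \<in> {B\<in>\<pi>. B \<subseteq> I}" "A \<noteq> B"
    then show "disjnt A B" using partition_onD2[OF NC_on_partition[OF assms(1)]]
      by (simp add: disjoint_def disjnt_def)
  qed (use partition_onD3[OF NC_on_partition[OF assms(1)]] in auto)
qed (rule NC_on_noncrossing[OF assms(1)]; simp)

lemma saturated_compl:
  assumes "\<pi> \<in> NC_on S" "saturated I \<pi>"
  shows "saturated (S - I) \<pi>"
  unfolding saturated_def
proof
  fix B assume B: "B \<in> \<pi>"
  from NC_onD_subset[OF assms(1) B] assms(2)[unfolded saturated_def, rule_format, OF B]
  show "B \<subseteq> S - I \<or> B \<inter> (S - I) = {}" by blast
qed

text \<open>If an interval is a union of blocks, the blocks inside and outside of it can be chosen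
  independently, since a crossing of an inner and an outer block would put an outer point between
  two points of the interval.\<close>

lemma bij_betw_NC_on_split:
  assumes I: "I \<subseteq> S"
    and convex: "\<And>x y z. x \<in> I \<Longrightarrow> z \<in> I \<Longrightarrow> y \<in> S \<Longrightarrow> x < y \<Longrightarrow> y < z \<Longrightarrow> y \<in> I"
  shows "bij_betw (\<lambda>(\<pi>, \<rho>). \<pi> \<union> \<rho>) (NC_on I \<times> NC_on (S - I)) {\<pi>\<in>NC_on S. saturated I \<pi>}"
proof (rule bij_betw_byWitness[where f' = "\<lambda>\<pi>. ({B\<in>\<pi>. B \<subseteq> I}, {B\<in>\<pi>. B \<subseteq> S - I})"])
  have sub: "\<pi> \<in> NC_on I \<Longrightarrow> C \<in> \<pi> \<Longrightarrow> C \<subseteq> I \<and> C \<noteq> {}"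
    "\<rho> \<in> NC_on (S - I) \<Longrightarrow> C \<in> \<rho> \<Longrightarrow> C \<subseteq> S - I \<and> C \<noteq> {}" for \<pi> \<rho> C
    using NC_onD_subset NC_on_partition partition_onD3 by metis+
  show "\<forall>p\<in>NC_on I \<times> NC_on (S - I).
    ({B \<in> case p of (\<pi>, \<rho>) \<Rightarrow> \<pi> \<union> \<rho>. B \<subseteq> I}, {B \<in> case p of (\<pi>, \<rho>) \<Rightarrow> \<pi> \<union> \<rho>. B \<subseteq> S - I}) = p"
  proof (clarify)
    fix \<pi> \<rho> assume "\<pi> \<in> NC_on I" "\<rho> \<in> NC_on (S - I)"
    then have *: "C \<in> \<pi> \<Longrightarrow> C \<subseteq> I \<and> C \<noteq> {}" "C \<in> \<rho> \<Longrightarrow> C \<subseteq> S - I \<and> C \<noteq> {}" for C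
      using sub by blast+
    have "{B \<in> \<pi> \<union> \<rho>. B \<subseteq> I} = \<pi>" "{B \<in> \<pi> \<union> \<rho>. B \<subseteq> S - I} = \<rho>"
      using * by blast+
    then show "{B \<in> \<pi> \<union> \<rho>. B \<subseteq> I} = \<pi> \<and> {B \<in> \<pi> \<union> \<rho>. B \<subseteq> S - I} = \<rho>" by blast
  qed
  show "\<forall>\<pi>\<in>{\<pi>\<in>NC_on S. saturated I \<pi>}.
    (case ({B \<in> \<pi>. B \<subseteq> I}, {B \<in> \<pi>. B \<subseteq> S - I}) of (\<pi>, \<rho>) \<Rightarrow> \<pi> \<union> \<rho>) = \<pi>"
  proof
    fix \<pi> assume \<pi>: "\<pi> \<in> {\<pi>\<in>NC_on S. saturated I \<pi>}"
    then have sat: "saturated I \<pi>" and NC: "\<pi> \<in> NC_on S" by simp_all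
    have "B \<subseteq> I \<or> B \<subseteq> S - I" if B: "B \<in> \<pi>" for B
      using NC_onD_subset[OF NC B] sat[unfolded saturated_def, rule_format, OF B] by blast
    then show "(case ({B \<in> \<pi>. B \<subseteq> I}, {B \<in> \<pi>. B \<subseteq> S - I}) of (\<pi>, \<rho>) \<Rightarrow> \<pi> \<union> \<rho>) = \<pi>" by auto
  qed
  show "(\<lambda>(\<pi>, \<rho>). \<pi> \<union> \<rho>) ` (NC_on I \<times> NC_on (S - I)) \<subseteq> {\<pi>\<in>NC_on S. saturated I \<pi>}"
  proof clarify
    fix \<pi> \<rho> assume h: "\<pi> \<in> NC_on I" "\<rho> \<in> NC_on (S - I)"
    have "saturated I (\<pi> \<union> \<rho>)"
      unfolding saturated_def
    proof
      fix B assume "B \<in> \<pi> \<union> \<rho>"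
      then show "B \<subseteq> I \<or> B \<inter> I = {}" using sub(1)[OF h(1), of B] sub(2)[OF h(2), of B] by blast
    qed
    moreover have "\<pi> \<union> \<rho> \<in> NC_on S" using NC_on_Un[OF h I convex] .
    ultimately show "\<pi> \<union> \<rho> \<in> NC_on S \<and> saturated I (\<pi> \<union> \<rho>)" by simp
  qed
  show "(\<lambda>\<pi>. ({B \<in> \<pi>. B \<subseteq> I}, {B \<in> \<pi>. B \<subseteq> S - I})) ` {\<pi>\<in>NC_on S. saturated I \<pi>}
    \<subseteq> NC_on I \<times> NC_on (S - I)"
  proof (rule image_subsetI)
    fix \<pi> assume "\<pi> \<in> {\<pi>\<in>NC_on S. saturated I \<pi>}"
    then have NC: "\<pi> \<in> NC_on S" and sat: "saturated I \<pi>" by simp_all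
    show "({B \<in> \<pi>. B \<subseteq> I}, {B \<in> \<pi>. B \<subseteq> S - I}) \<in> NC_on I \<times> NC_on (S - I)"
      using NC_on_restrict[OF NC sat I] NC_on_restrict[OF NC saturated_compl[OF NC sat]] by simp
  qed
qed

definition unsaturated_sum :: "(nat set \<Rightarrow> complex) \<Rightarrow> nat set \<Rightarrow> nat set list \<Rightarrow> complex" where
  "unsaturated_sum g S Is = (\<Sum>\<pi> | \<pi> \<in> NC_on S \<and> (\<forall>J\<in>set Is. \<not> saturated J \<pi>). \<Prod>B\<in>\<pi>. g B)"

lemma unsaturated_sum_Nil: "unsaturated_sum g S [] = (\<Sum>\<pi>\<in>NC_on S. \<Prod>B\<in>\<pi>. g B)"
  by (simp add: unsaturated_sum_def)

text \<open>The partitions that have to be subtracted are those in which \<open>I\<close> is a union of blocks; their sum factorizes.\<close>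

lemma unsaturated_sum_Cons:
  assumes I: "I \<subseteq> S" and S: "finite S"
    and convex: "\<And>x y z. x \<in> I \<Longrightarrow> z \<in> I \<Longrightarrow> y \<in> S \<Longrightarrow> x < y \<Longrightarrow> y < z \<Longrightarrow> y \<in> I"
    and disj: "\<And>J. J \<in> set Is \<Longrightarrow> J \<inter> I = {}"
  shows "unsaturated_sum g S (I # Is) =
    unsaturated_sum g S Is - (\<Sum>\<pi>\<in>NC_on I. \<Prod>B\<in>\<pi>. g B) * unsaturated_sum g (S - I) Is"
proof -
  let ?U = "\<lambda>\<pi>. \<forall>J\<in>set Is. \<not> saturated J \<pi>"
  let ?F = "\<lambda>\<pi>. \<Prod>B\<in>\<pi>. g B"
  let ?h = "\<lambda>\<pi>. if ?U \<pi> then ?F \<pi> else 0"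
  have fin: "finite (NC_on S)" "finite I" "finite (S - I)" using S I finite_NC_on finite_subset by auto
  have sat: "saturated J (\<pi> \<union> \<rho>) \<longleftrightarrow> saturated J \<rho>" if "J \<in> set Is" "\<pi> \<in> NC_on I" for J \<pi> \<rho>
    using disj[OF that(1)] NC_onD_subset[OF that(2)] unfolding saturated_def by blast
  have "(\<Sum>\<pi> | \<pi> \<in> NC_on S \<and> saturated I \<pi> \<and> ?U \<pi>. ?F \<pi>) = (\<Sum>\<pi> | \<pi> \<in> NC_on S \<and> saturated I \<pi>. ?h \<pi>)"
    using fin(1) by (intro sum.mono_neutral_cong_left) auto
  also have "\<dots> = (\<Sum>p\<in>NC_on I \<times> NC_on (S - I). ?h ((\<lambda>(\<pi>, \<rho>). \<pi> \<union> \<rho>) p))"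
    by (rule sum.reindex_bij_betw[OF bij_betw_NC_on_split[OF I convex], symmetric])
  also have "\<dots> = (\<Sum>p\<in>NC_on I \<times> NC_on (S - I). ?F (fst p) * ?h (snd p))"
  proof (rule sum.cong[OF refl], clarify)
    fix \<pi> \<rho> assume h: "\<pi> \<in> NC_on I" "\<rho> \<in> NC_on (S - I)"
    have "C \<noteq> {}" if "C \<in> \<pi>" for C using h(1) that NC_on_partition partition_onD3 by metis
    then have "\<pi> \<inter> \<rho> = {}" using NC_onD_subset[OF h(1)] NC_onD_subset[OF h(2)] by blast
    moreover have "finite \<pi>" "finite \<rho>" using h fin finite_NC_on_member by blast+
    ultimately have "?F (\<pi> \<union> \<rho>) = ?F \<pi> * ?F \<rho>" by (intro prod.union_disjoint)
    moreover have "?U (\<pi> \<union> \<rho>) \<longleftrightarrow> ?U \<rho>" using sat h by blast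
    ultimately show "?h (\<pi> \<union> \<rho>) = ?F (fst (\<pi>, \<rho>)) * ?h (snd (\<pi>, \<rho>))" by simp
  qed
  also have "\<dots> = (\<Sum>\<pi>\<in>NC_on I. ?F \<pi>) * (\<Sum>\<rho>\<in>NC_on (S - I). ?h \<rho>)"
    by (simp add: sum_product sum.cartesian_product case_prod_beta)
  also have "(\<Sum>\<rho>\<in>NC_on (S - I). ?h \<rho>) = unsaturated_sum g (S - I) Is"
    unfolding unsaturated_sum_def using finite_NC_on[OF fin(3)] by (simp add: sum.inter_filter)
  finally have 1: "(\<Sum>\<pi> | \<pi> \<in> NC_on S \<and> saturated I \<pi> \<and> ?U \<pi>. ?F \<pi>) =
    (\<Sum>\<pi>\<in>NC_on I. ?F \<pi>) * unsaturated_sum g (S - I) Is" .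
  have "unsaturated_sum g S Is = (\<Sum>\<pi> | \<pi> \<in> NC_on S \<and> saturated I \<pi> \<and> ?U \<pi>. ?F \<pi>) +
      unsaturated_sum g S (I # Is)"
    unfolding unsaturated_sum_def using fin(1)
    by (subst sum.union_disjoint[symmetric]) (auto intro!: sum.cong)
  with 1 show ?thesis by simp
qed

section \<open>Mixed words and runs of equal letters\<close>

definition mixed :: "'i list \<Rightarrow> bool" where
  "mixed w \<longleftrightarrow> (\<forall>i. \<not> set w \<subseteq> {i})"

lemma mixed_nthsI:
  assumes "p \<in> B" "q \<in> B" "p < length w" "q < length w" "w ! p \<noteq> w ! q"
  shows "mixed (nths w B)"
proof -
  have "w ! p \<in> set (nths w B)" "w ! q \<in> set (nths w B)" using assms by (auto simp: set_nths)
  with assms(5) show ?thesis unfolding mixed_def by blast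
qed

lemma not_mixed_iff_replicate: "\<not> mixed w \<longleftrightarrow> (\<exists>i. w = replicate (length w) i)"
proof
  assume "\<not> mixed w"
  then obtain i where "set w \<subseteq> {i}" by (auto simp: mixed_def)
  then show "\<exists>i. w = replicate (length w) i"
    by (intro exI[of _ i] replicate_eqI) auto
next
  assume "\<exists>i. w = replicate (length w) i"
  then obtain i where "w = replicate (length w) i" by blast
  then have "set w \<subseteq> {i}" by (metis set_replicate_conv_if empty_subsetI subset_refl)
  then show "\<not> mixed w" by (auto simp: mixed_def)
qed

definition flatten :: "('i \<times> nat) list \<Rightarrow> 'i list" where
  "flatten rs = concat (map (\<lambda>(i, k). replicate k i) rs)"

lemma flatten_simps [simp]:
  "flatten [] = []" "flatten ((i, k) # rs) = replicate k i @ flatten rs"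
  by (simp_all add: flatten_def)

definition alternating :: "('i \<times> nat) list \<Rightarrow> bool" where
  "alternating rs \<longleftrightarrow> rs \<noteq> [] \<and> distinct_adj (map fst rs) \<and> (\<forall>r\<in>set rs. 0 < snd r)"

lemma ex_alternating_flatten: "w \<noteq> [] \<Longrightarrow> \<exists>rs. alternating rs \<and> flatten rs = w"
proof (induction w)
  case (Cons x w)
  show ?case
  proof (cases "w = []")
    case True
    then show ?thesis by (intro exI[of _ "[(x, 1)]"]) (simp add: alternating_def)
  next
    case False
    then obtain rs where rs: "alternating rs" "flatten rs = w" using Cons.IH by blast
    then obtain i k rs' where eq: "rs = (i, k) # rs'" by (cases rs) (auto simp: alternating_def)
    show ?thesis
    proof (cases "x = i")
      case True
      with rs eq show ?thesis
        by (intro exI[of _ "(i, Suc k) # rs'"]) (auto simp: alternating_def distinct_adj_Cons)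
    next
      case False
      with rs eq show ?thesis
        by (intro exI[of _ "(x, 1) # rs"]) (auto simp: alternating_def distinct_adj_Cons)
    qed
  qed
qed simp

section \<open>Expansions of products of centered powers\<close>

text \<open>If \<open>m\<close> consists of the joint moments of a family \<open>a\<close>, this is the expansion of the expectation
  of \<open>a\<^sub>u\<close> times the product of \<open>a\<^sub>i^k - m(i^k)\<close> over the runs \<open>(i, k)\<close>. The prefix \<open>u\<close>
  collects the runs for which the power has been chosen.\<close>

fun centered_moment :: "('i list \<Rightarrow> complex) \<Rightarrow> 'i list \<Rightarrow> ('i \<times> nat) list \<Rightarrow> complex" where
  "centered_moment m u [] = m u"
| "centered_moment m u ((i, k) # rs) =
     centered_moment m (u @ replicate k i) rs - m (replicate k i) * centered_moment m u rs"

definition free_moments :: "('i list \<Rightarrow> complex) \<Rightarrow> bool" where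
  "free_moments m \<longleftrightarrow> (\<forall>rs. alternating rs \<longrightarrow> centered_moment m [] rs = 0)"

section \<open>Monochromatic non-crossing partitions\<close>

fun run_sets :: "nat \<Rightarrow> ('i \<times> nat) list \<Rightarrow> nat set list" where
  "run_sets p [] = []"
| "run_sets p ((i, k) # rs) = {p..<p + k} # run_sets (p + k) rs"

lemma length_run_sets [simp]: "length (run_sets p rs) = length rs"
  by (induction p rs rule: run_sets.induct) auto

lemma run_sets_ge: "J \<in> set (run_sets p rs) \<Longrightarrow> q \<in> J \<Longrightarrow> p \<le> q"
  by (induction p rs rule: run_sets.induct) fastforce+

lemma run_sets_cover:
  "p \<le> q \<Longrightarrow> q < p + length (flatten rs) \<Longrightarrow>
    \<exists>j<length rs. q \<in> run_sets p rs ! j"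
proof (induction p rs rule: run_sets.induct)
  case (2 p i k rs)
  show ?case
  proof (cases "q < p + k")
    case True
    with 2 show ?thesis by (intro exI[of _ 0]) simp
  next
    case False
    with 2 obtain j where "j < length rs" "q \<in> run_sets (p + k) rs ! j" by auto
    then show ?thesis by (intro exI[of _ "Suc j"]) simp
  qed
qed simp

lemma run_sets_letter:
  "j < length rs \<Longrightarrow> q \<in> run_sets p rs ! j \<Longrightarrow>
    q - p < length (flatten rs) \<and> flatten rs ! (q - p) = fst (rs ! j)"
proof (induction p rs arbitrary: j rule: run_sets.induct)
  case (2 p i k rs)
  show ?case
  proof (cases j)
    case 0
    with 2 show ?thesis by (auto simp: nth_append)
  next
    case (Suc j')
    with 2 have *: "q - (p + k) < length (flatten rs) \<and> flatten rs ! (q - (p + k)) = fst (rs ! j')"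
      by simp
    have "p + k \<le> q" using 2(2,3) Suc run_sets_ge[of "run_sets (p + k) rs ! j'" "p + k" rs q] by simp
    with * Suc show ?thesis by (auto simp: nth_append)
  qed
qed simp

lemma run_sets_less:
  "j < j' \<Longrightarrow> j' < length rs \<Longrightarrow> q \<in> run_sets p rs ! j \<Longrightarrow> q' \<in> run_sets p rs ! j' \<Longrightarrow> q < q'"
proof (induction p rs arbitrary: j j' rule: run_sets.induct)
  case (2 p i k rs)
  then obtain l' where l': "j' = Suc l'" by (cases j') auto
  show ?case
  proof (cases j)
    case 0
    have "p + k \<le> q'" using 2(3,5) l' run_sets_ge[of "run_sets (p + k) rs ! l'" "p + k" rs q'] by simp
    with 0 2 show ?thesis by auto
  next
    case (Suc l)
    with 2 l' show ?thesis by auto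
  qed
qed simp

text \<open>Suppose that every run is connected to another one by some block, and choose a connection
  \<open>p < q\<close> of shortest length. Both positions carry the same letter, so their runs are not
  neighbours, and the run after that of \<open>p\<close> lies between \<open>p\<close> and \<open>q\<close>. Its letter is different, hence
  the block that connects it to another run differs from the block of \<open>p\<close> and \<open>q\<close>, and must stay
  strictly between \<open>p\<close> and \<open>q\<close>. This connection is shorter.\<close>

lemma monochromatic_NC_has_saturated_run:
  assumes rs: "alternating rs" and \<pi>: "\<pi> \<in> NC_on {..<length (flatten rs)}"
    and mono: "\<And>B p q. B \<in> \<pi> \<Longrightarrow> p \<in> B \<Longrightarrow> q \<in> B \<Longrightarrow> flatten rs ! p = flatten rs ! q"
  shows "\<exists>J\<in>set (run_sets 0 rs). saturated J \<pi>"
proof (rule ccontr)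
  assume neg: "\<not> ?thesis"
  let ?w = "flatten rs" and ?R = "run_sets 0 rs"
  have part: "partition_on {..<length ?w} \<pi>" using \<pi> by (rule NC_on_partition)
  have cover: "\<exists>j<length rs. q \<in> ?R ! j" if "B \<in> \<pi>" "q \<in> B" for B q
    using NC_onD_subset[OF \<pi> that(1)] that(2) by (intro run_sets_cover) auto
  have letter: "?w ! q = fst (rs ! j)" if "j < length rs" "q \<in> ?R ! j" for q j
    using run_sets_letter[OF that] by simp
  have unsat: "\<exists>B x y. B \<in> \<pi> \<and> x \<in> B \<and> x \<in> ?R ! j \<and> y \<in> B \<and> y \<notin> ?R ! j" if "j < length rs" for j
  proof -
    have "\<not> saturated (?R ! j) \<pi>" using neg that by auto
    then obtain B where "B \<in> \<pi>" "\<not> B \<subseteq> ?R ! j" "B \<inter> ?R ! j \<noteq> {}" unfolding saturated_def by blast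
    then show ?thesis by blast
  qed
  have False if "B \<in> \<pi>" "p \<in> B" "q \<in> B" "j < j'" "j' < length rs" "p \<in> ?R ! j" "q \<in> ?R ! j'"
    for B p q j j'
    using that
  proof (induction "q - p" arbitrary: B p q j j' rule: less_induct)
    case less
    note B = less.prems(1-3) and j = less.prems(4,5) and R = less.prems(6,7)
    have "fst (rs ! j) = fst (rs ! j')"
      using mono[OF B] letter[of j p] letter[of j' q] j R by simp
    moreover have ne: "fst (rs ! Suc j) \<noteq> fst (rs ! j)"
      using rs j unfolding alternating_def distinct_adj_conv_nth
      by (metis (no_types, lifting) Suc_leI Suc_less_eq length_map less_trans_Suc nth_map Suc_lessD
          diff_Suc_1 less_diff_conv Suc_eq_plus1 le_less_trans)
    ultimately have sj: "Suc j < j'" using j by (metis Suc_lessI)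
    then have sjl: "Suc j < length rs" using j by simp
    obtain C x y where C: "C \<in> \<pi>" "x \<in> C" "x \<in> ?R ! Suc j" "y \<in> C" "y \<notin> ?R ! Suc j"
      using unsat[OF sjl] by blast
    have pxq: "p < x" "x < q"
      using run_sets_less[OF _ sjl R(1) C(3)] run_sets_less[OF sj j(2) C(3) R(2)] by simp_all
    have CB: "C \<noteq> B" using ne mono[OF C(1,2), of p] B(2) letter[OF sjl C(3)] letter[of j p] j R by auto
    then have "y \<noteq> p" "y \<noteq> q" using partition_on_same_block[OF part C(1) B(1) C(4)] B by blast+
    moreover have "\<not> y < p"
      using NC_on_noncrossing[OF \<pi> C(1) B(1) _ pxq C(4,2) B(2,3)] CB by blast
    moreover have "\<not> q < y"
      using NC_on_noncrossing[OF \<pi> B(1) C(1) pxq _ B(2,3) C(2,4)] CB by blast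
    ultimately have y: "p < y" "y < q" by simp_all
    obtain l where l: "l < length rs" "y \<in> ?R ! l" using cover[OF C(1,4)] by blast
    with C(5) consider "l < Suc j" | "Suc j < l" by (metis nat_neq_iff)
    then show False
    proof cases
      case 1
      have "y < x" using run_sets_less[OF 1 sjl l(2) C(3)] .
      with less.hyps[of x y, OF _ C(1,4,2) 1 sjl l(2) C(3)] y pxq show False by linarith
    next
      case 2
      have "x < y" using run_sets_less[OF 2 l(1) C(3) l(2)] .
      with less.hyps[of y x, OF _ C(1,2,4) 2 l(1) C(3) l(2)] y pxq show False by linarith
    qed
  qed
  moreover have l: "0 < length rs" using rs by (simp add: alternating_def)
  obtain B x y where B: "B \<in> \<pi>" "x \<in> B" "x \<in> ?R ! 0" "y \<in> B" "y \<notin> ?R ! 0"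
    using unsat[OF l] by blast
  obtain j where j: "j < length rs" "y \<in> ?R ! j" using cover[OF B(1,4)] by blast
  with B(5) have "0 < j" by (metis gr0I)
  ultimately show False using B j by blast
qed

section \<open>Freeness of moments and mixed cumulants\<close>

lemma nths_cong_positions:
  assumes "\<And>i. i < length xs \<Longrightarrow> i \<in> A \<longleftrightarrow> i \<in> B"
  shows "nths xs A = nths xs B"
  unfolding nths_def using assms by (auto simp: set_zip intro!: arg_cong[where f = "map fst"] filter_cong)

lemma nths_disjoint: "(\<And>i. i < length xs \<Longrightarrow> i \<notin> A) \<Longrightarrow> nths xs A = []"
  using nths_cong_positions[of xs A "{}"] by simp

lemma nths_append3:
  assumes U: "U \<subseteq> {..<length x}"
  shows "nths (x @ r @ t) (U \<union> {length x..<length x + length r}) = nths (x @ r @ t) U @ r"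
    and "nths (x @ r @ t) {length x..<length x + length r} = r"
proof -
  have 1: "nths x (U \<union> {length x..<length x + length r}) = nths x U"
    by (rule nths_cong_positions) simp
  have 2: "nths r {j. j + length x \<in> U \<union> {length x..<length x + length r}} = r"
    using U by (intro nths_all) auto
  have 3: "nths t {j. j + length r \<in> {j. j + length x \<in> U \<union> {length x..<length x + length r}}} = []"
    using U by (intro nths_disjoint) auto
  have 4: "nths (r @ t) {j. j + length x \<in> U} = []"
    using U by (intro nths_disjoint) auto
  show "nths (x @ r @ t) (U \<union> {length x..<length x + length r}) = nths (x @ r @ t) U @ r"
    by (simp only: nths_append[of x] nths_append[of r t "{j. j + length x \<in> U \<union> {length x..<length x + length r}}"] 1 2 3 4 append_Nil2)
  have 5: "nths x {length x..<length x + length r} = []"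
    by (intro nths_disjoint) auto
  have 6: "nths r {j. j + length x \<in> {length x..<length x + length r}} = r"
    by (intro nths_all) auto
  have 7: "nths t {j. j + length r \<in> {j. j + length x \<in> {length x..<length x + length r}}} = []"
    by (intro nths_disjoint) auto
  show "nths (x @ r @ t) {length x..<length x + length r} = r"
    by (simp only: nths_append[of x] nths_append[of r t "{j. j + length x \<in> {length x..<length x + length r}}"] 5 6 7 append_Nil2 append_Nil)
qed

text \<open>Subtracting \<open>m(i^k)\<close> from a power removes the partitions in which this run is a union of
  blocks. In the induction the word \<open>w\<close> stays fixed; \<open>x\<close> is the part of it that has been
  processed, and \<open>U\<close> the set of those of its positions that have not been removed.\<close>

lemma centered_moment_eq_unsaturated_sum:
  assumes "w = x @ flatten rs" "U \<subseteq> {..<length x}"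
  shows "centered_moment (moment f) (nths w U) rs =
    unsaturated_sum (\<lambda>B. f (nths w B)) (U \<union> {length x..<length w}) (run_sets (length x) rs)"
  using assms
proof (induction rs arbitrary: x U)
  case Nil
  then show ?case by (simp add: unsaturated_sum_Nil moment_nths)
next
  case (Cons r rs)
  obtain i k where r: "r = (i, k)" by (cases r)
  let ?p = "length x" and ?g = "\<lambda>B. f (nths w B)"
  let ?I = "{?p..<?p + k}" and ?S = "U \<union> {?p..<length w}"
  have w: "w = x @ replicate k i @ flatten rs" using Cons.prems r by simp
  have w': "w = (x @ replicate k i) @ flatten rs" using w by simp
  have I: "nths w (U \<union> ?I) = nths w U @ replicate k i" "nths w ?I = replicate k i"
    using nths_append3[OF Cons.prems(2), of "replicate k i" "flatten rs"] unfolding w by simp_all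
  have U1: "U \<union> ?I \<subseteq> {..<length (x @ replicate k i)}" and U2: "U \<subseteq> {..<length (x @ replicate k i)}"
    using Cons.prems(2) by auto
  have S1: "U \<union> ?I \<union> {length (x @ replicate k i)..<length w} = ?S"
    and S2: "U \<union> {length (x @ replicate k i)..<length w} = ?S - ?I"
    using Cons.prems(2) unfolding w by auto
  have "unsaturated_sum ?g ?S (?I # run_sets (?p + k) rs) = unsaturated_sum ?g ?S (run_sets (?p + k) rs) -
      (\<Sum>\<pi>\<in>NC_on ?I. \<Prod>B\<in>\<pi>. ?g B) * unsaturated_sum ?g (?S - ?I) (run_sets (?p + k) rs)"
  proof (rule unsaturated_sum_Cons)
    show "?I \<subseteq> ?S" unfolding w by auto
    show "finite ?S" using Cons.prems(2) finite_subset by auto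
    show "J \<inter> ?I = {}" if "J \<in> set (run_sets (?p + k) rs)" for J
      using run_sets_ge[OF that] by force
  qed auto
  also have "(\<Sum>\<pi>\<in>NC_on ?I. \<Prod>B\<in>\<pi>. ?g B) = moment f (replicate k i)"
  proof -
    have "?I \<subseteq> {..<length w}" unfolding w by auto
    from moment_nths[OF this, of f] show ?thesis by (simp only: I(2))
  qed
  finally show ?case
    using Cons.IH[OF w' U1] Cons.IH[OF w' U2] unfolding S1 S2 I r by simp
qed

lemma free_moments_if_mixed_vanish:
  assumes "\<And>w. mixed w \<Longrightarrow> f w = 0"
  shows "free_moments (moment f)"
  unfolding free_moments_def
proof (intro allI impI)
  fix rs :: "('a \<times> nat) list" assume rs: "alternating rs"
  let ?w = "flatten rs"
  have "centered_moment (moment f) (nths ?w {}) rs =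
    unsaturated_sum (\<lambda>B. f (nths ?w B)) ({} \<union> {length ([] :: 'a list)..<length ?w}) (run_sets (length ([] :: 'a list)) rs)"
    by (rule centered_moment_eq_unsaturated_sum) simp_all
  then have "centered_moment (moment f) [] rs = unsaturated_sum (\<lambda>B. f (nths ?w B)) {..<length ?w} (run_sets 0 rs)"
    by (simp add: atLeast0LessThan)
  also have "\<dots> = 0"
    unfolding unsaturated_sum_def
  proof (rule sum.neutral, clarify)
    fix \<pi> assume \<pi>: "\<pi> \<in> NC_on {..<length ?w}" and unsat: "\<forall>J\<in>set (run_sets 0 rs). \<not> saturated J \<pi>"
    obtain B p q where B: "B \<in> \<pi>" "p \<in> B" "q \<in> B" "?w ! p \<noteq> ?w ! q"
      using monochromatic_NC_has_saturated_run[OF rs \<pi>] unsat by blast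
    then have "p < length ?w" "q < length ?w" using NC_onD_subset[OF \<pi> B(1)] by blast+
    then have "f (nths ?w B) = 0" using B by (intro assms mixed_nthsI)
    then show "(\<Prod>B\<in>\<pi>. f (nths ?w B)) = 0"
      using B(1) finite_NC_on_member[OF _ \<pi>] by (intro prod_zero) auto
  qed
  finally show "centered_moment (moment f) [] rs = 0" .
qed

text \<open>All terms of the expansion except the leading one concern shorter words or powers of a
  single letter.\<close>

lemma centered_moment_diff:
  assumes "\<And>v. length v < N \<Longrightarrow> m v = m' v" "\<And>k i. m (replicate k i) = m' (replicate k i)"
    and "length u + length (flatten rs) \<le> N" "\<forall>r\<in>set rs. 0 < snd r"
  shows "centered_moment m u rs - centered_moment m' u rs = m (u @ flatten rs) - m' (u @ flatten rs)"
  using assms(3,4)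
proof (induction rs arbitrary: u)
  case (Cons r rs)
  obtain i k where r: "r = (i, k)" by (cases r)
  have k: "0 < k" using Cons.prems r by simp
  have "centered_moment m (u @ replicate k i) rs - centered_moment m' (u @ replicate k i) rs =
    m (u @ flatten (r # rs)) - m' (u @ flatten (r # rs))"
    using Cons.IH[of "u @ replicate k i"] Cons.prems r by simp
  moreover have "centered_moment m u rs = centered_moment m' u rs"
    using Cons.IH[of u] Cons.prems r k assms(1)[of "u @ flatten rs"] by simp
  ultimately show ?case using r assms(2) by simp
qed simp

lemma free_moments_unique:
  assumes "free_moments m" "free_moments m'" "\<And>k i. m (replicate k i) = m' (replicate k i)"
  shows "m = m'"
proof
  fix w show "m w = m' w"
  proof (induction w rule: length_induct)
    case (1 w)
    show ?case
    proof (cases "w = []")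
      case True
      then show ?thesis using assms(3)[of 0] by simp
    next
      case False
      then obtain rs where rs: "alternating rs" "flatten rs = w" using ex_alternating_flatten by blast
      have "centered_moment m [] rs - centered_moment m' [] rs = m ([] @ flatten rs) - m' ([] @ flatten rs)"
        using 1 rs by (intro centered_moment_diff[of "length w"] assms(3)) (auto simp: alternating_def)
      with assms(1,2) rs show ?thesis by (simp add: free_moments_def)
    qed
  qed
qed

lemma nths_replicate_same: "\<exists>l. nths (replicate k i) B = replicate l i"
proof -
  have "\<forall>x\<in>set (nths (replicate k i) B). x = i"
    using set_nths_subset[of "replicate k i" B] by auto
  then show ?thesis by (metis replicate_eqI)
qed

lemma not_mixed_replicate: "\<not> mixed (replicate k i)"
  unfolding not_mixed_iff_replicate by simp

text \<open>For the forward direction, the moments are compared with those that arise when the mixed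
  cumulants are replaced by \<open>0\<close>. The latter are free, and both agree on powers of a single
  letter, where no mixed cumulant occurs.\<close>

theorem free_moments_iff_mixed_cumulants_vanish:
  assumes "m [] = 1"
  shows "free_moments m \<longleftrightarrow> (\<forall>w. mixed w \<longrightarrow> cumulant m w = 0)"
proof
  have m: "moment (cumulant m) = m"
  proof
    fix w show "moment (cumulant m) w = m w"
      by (cases "w = []") (simp_all add: moment_Nil assms moment_cumulant)
  qed
  {
    assume "\<forall>w. mixed w \<longrightarrow> cumulant m w = 0"
    then show "free_moments m" using free_moments_if_mixed_vanish[of "cumulant m"] m by simp
  }
  assume free: "free_moments m"
  define f where "f w = (if mixed w then 0 else cumulant m w)" for w
  have pure: "moment f (replicate k i) = m (replicate k i)" for k i
  proof -
    have "f (nths (replicate k i) B) = cumulant m (nths (replicate k i) B)" for B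
      using nths_replicate_same[of k i B] not_mixed_replicate by (metis f_def)
    then have "moment f (replicate k i) = moment (cumulant m) (replicate k i)"
      unfolding moment_def Cf_part_def by simp
    then show ?thesis by (simp add: m)
  qed
  have "free_moments (moment f)" by (rule free_moments_if_mixed_vanish) (simp add: f_def)
  then have "moment f = m" using free pure by (intro free_moments_unique)
  then have "f = cumulant m"
    using m by (intro moment_inject) (simp_all add: f_def mixed_def)
  then show "\<forall>w. mixed w \<longrightarrow> cumulant m w = 0" by (metis f_def)
qed

section \<open>Freeness in terms of joint moments\<close>

context nc_probability_space
begin

lemma functional_simps:
  "\<phi> (x + y) = \<phi> x + \<phi> y" "\<phi> (x - y) = \<phi> x - \<phi> y" "\<phi> (sc c x) = c * \<phi> x" "\<phi> 0 = 0"
  using linear_functional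
  by (simp_all add: Vector_Spaces.linear_iff_module_hom module_hom.add module_hom.diff module_hom.scale module_hom.zero)

definition centered_power :: "'a \<Rightarrow> nat \<Rightarrow> 'a" where
  "centered_power x k = x ^ k - sc (\<phi> (x ^ k)) 1"

lemma functional_centered_product:
  "\<phi> (prod_list (map a u) * prod_list (map (\<lambda>(i, k). centered_power (a i) k) rs)) =
    centered_moment (\<lambda>w. \<phi> (prod_list (map a w))) u rs"
proof (induction rs arbitrary: u)
  case (Cons r rs)
  obtain i k where r: "r = (i, k)" by (cases r)
  let ?u = "prod_list (map a u)" and ?P = "prod_list (map (\<lambda>(i, k). centered_power (a i) k) rs)"
  have "\<phi> (?u * (centered_power (a i) k * ?P)) =
    \<phi> (?u * a i ^ k * ?P) - \<phi> (a i ^ k) * \<phi> (?u * ?P)"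
    by (simp add: centered_power_def algebra_simps scale_mult_left scale_mult_right functional_simps)
  also have "\<phi> (?u * a i ^ k * ?P) = centered_moment (\<lambda>w. \<phi> (prod_list (map a w))) (u @ replicate k i) rs"
    using Cons.IH[of "u @ replicate k i"] by (simp add: prod_list_replicate)
  finally show ?case using Cons.IH[of u] r by (simp add: prod_list_replicate)
qed simp

lemma functional_centered_power: "\<phi> (centered_power x k) = 0"
  by (simp add: centered_power_def functional_simps functional_one)

lemma subalgebra_power: "unital_subalgebra sc B \<Longrightarrow> x \<in> B \<Longrightarrow> x ^ k \<in> B"
  by (induction k) (auto simp: unital_subalgebra_def)

lemma centered_power_in_hull: "centered_power x k \<in> unital_subalgebra sc hull {x}"
  unfolding hull_def
proof (rule InterI, clarify)
  fix B assume B: "unital_subalgebra sc B" "{x} \<subseteq> B"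
  then show "centered_power x k \<in> B"
    using subalgebra_power[OF B(1), of x k]
    by (auto simp: centered_power_def unital_subalgebra_def intro: subspace_diff subspace_scale)
qed

lemma unital_subalgebra_span_powers: "unital_subalgebra sc (span (range (\<lambda>k. x ^ k)))"
  unfolding unital_subalgebra_def
proof (intro conjI ballI)
  let ?P = "range (\<lambda>k. x ^ k)"
  show "1 \<in> span ?P" by (rule span_base) (metis power_0 rangeI)
  fix y z assume y: "y \<in> span ?P" and z: "z \<in> span ?P"
  have pz: "x ^ k * z \<in> span ?P" for k
    using z
  proof (induction rule: span_induct)
    case (step y)
    then show ?case by (auto intro!: span_base simp flip: power_add)
  next
    case base
    show ?case by (rule subspaceI)
        (auto simp: distrib_left scale_mult_right intro: span_zero span_add span_scale)
  qed
  show "y * z \<in> span ?P"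
    using y
  proof (induction rule: span_induct)
    case base
    show ?case by (rule subspaceI)
        (auto simp: distrib_right scale_mult_left intro: span_zero span_add span_scale)
  qed (use pz in auto)
qed simp

text \<open>Centering \<open>c \<mapsto> c - \<phi>(c)\<close> is linear and sends each power of \<open>x\<close> to a centered power, and the
  zeroth power to \<open>0\<close>.\<close>

lemma hull_centered_in_span:
  assumes "c \<in> unital_subalgebra sc hull {x}" "\<phi> c = 0"
  shows "c \<in> span (centered_power x ` {0<..})"
proof -
  have "x \<in> span (range (\<lambda>k. x ^ k))" by (rule span_base) (metis power_one_right rangeI)
  then have "unital_subalgebra sc hull {x} \<subseteq> span (range (\<lambda>k. x ^ k))"
    by (intro hull_minimal unital_subalgebra_span_powers) simp
  then have "c \<in> span (range (\<lambda>k. x ^ k))" using assms(1) by blast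
  then have "c - sc (\<phi> c) 1 \<in> span (centered_power x ` {0<..})"
  proof (induction rule: span_induct)
    case (step y)
    then obtain k where k: "y = x ^ k" by blast
    then have y: "y - sc (\<phi> y) 1 = centered_power x k" by (simp add: centered_power_def)
    show ?case
    proof (cases "k = 0")
      case True
      then show ?thesis using y by (simp add: centered_power_def functional_one span_zero)
    next
      case False
      then show ?thesis unfolding y by (intro span_base) simp
    qed
  next
    case base
    have *: "(x + y) - sc (\<phi> (x + y)) 1 = (x - sc (\<phi> x) 1) + (y - sc (\<phi> y) 1)"
      "sc c x - sc (\<phi> (sc c x)) 1 = sc c (x - sc (\<phi> x) 1)" for x y c
      by (simp_all add: functional_simps scale_left_distrib scale_right_diff_distrib)
    show ?case
      by (rule subspaceI) (auto simp: * functional_simps(4) intro: span_zero span_add span_scale)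
  qed
  then show ?thesis using assms(2) by simp
qed

text \<open>Multilinearity: the factors are replaced one after the other by centered powers, which are
  collected in the prefix \<open>ds\<close>.\<close>

lemma free_moments_imp_product_vanishes:
  assumes free: "free_moments (\<lambda>w. \<phi> (prod_list (map a w)))"
    and "list_all2 (\<lambda>i c. c \<in> span (centered_power (a i) ` {0<..})) is cs"
    and "distinct_adj (map fst ds @ is)" "ds \<noteq> [] \<or> is \<noteq> []" "\<forall>d\<in>set ds. 0 < snd d"
  shows "\<phi> (prod_list (map (\<lambda>(i, k). centered_power (a i) k) ds) * prod_list cs) = 0"
  using assms(2-)
proof (induction arbitrary: ds rule: list_all2_induct)
  case Nil
  then have "alternating ds" by (simp add: alternating_def)
  then show ?case using functional_centered_product[of a "[]" ds] free by (simp add: free_moments_def)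
next
  case (Cons i "is" c cs)
  let ?P = "\<lambda>ds. prod_list (map (\<lambda>(i, k). centered_power (a i) k) ds)"
  have "\<phi> (?P ds * (c * prod_list cs)) = 0"
    using Cons.hyps(1)
  proof (induction rule: span_induct)
    case (step c)
    then obtain k where k: "c = centered_power (a i) k" "0 < k" by auto
    have "\<phi> (?P (ds @ [(i, k)]) * prod_list cs) = 0"
      using Cons.prems k by (intro Cons.IH) auto
    then show ?case using k by (simp add: mult.assoc)
  next
    case base
    show ?case by (rule subspaceI)
        (auto simp: distrib_left distrib_right scale_mult_left scale_mult_right functional_simps)
  qed
  then show ?case by simp
qed

theorem freely_independent_iff_free_moments:
  "freely_independent sc \<phi> a \<longleftrightarrow> free_moments (\<lambda>w. \<phi> (prod_list (map a w)))"
proof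
  assume free: "freely_independent sc \<phi> a"
  show "free_moments (\<lambda>w. \<phi> (prod_list (map a w)))"
    unfolding free_moments_def
  proof (intro allI impI)
    fix rs :: "('b \<times> nat) list" assume rs: "alternating rs"
    let ?cs = "map (\<lambda>(i, k). centered_power (a i) k) rs"
    have "\<phi> (prod_list ?cs) = 0"
      using rs free[unfolded freely_independent_def, rule_format, of "map fst rs" ?cs]
      by (auto simp: alternating_def case_prod_beta centered_power_in_hull functional_centered_power)
    then show "centered_moment (\<lambda>w. \<phi> (prod_list (map a w))) [] rs = 0"
      using functional_centered_product[of a "[]" rs] by simp
  qed
next
  assume free: "free_moments (\<lambda>w. \<phi> (prod_list (map a w)))"
  show "freely_independent sc \<phi> a"
    unfolding freely_independent_def
  proof (intro allI impI, elim conjE)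
    fix "is" cs assume h: "is \<noteq> []" "length cs = length is" "distinct_adj is"
      "\<forall>j<length is. cs ! j \<in> unital_subalgebra sc hull {a (is ! j)} \<and> \<phi> (cs ! j) = 0"
    have "list_all2 (\<lambda>i c. c \<in> span (centered_power (a i) ` {0<..})) is cs"
      using h hull_centered_in_span by (simp add: list_all2_conv_all_nth)
    from free_moments_imp_product_vanishes[OF free this, of "[]"] h show "\<phi> (prod_list cs) = 0" by simp
  qed
qed

end

section \<open>Characters and their convolution\<close>

definition character :: "'i ncps \<Rightarrow> 'i yalg \<Rightarrow> complex" where
  "character = yalg_hom id"

lemma character_add: "character g (p + q) = character g p + character g q"
  unfolding character_def by (rule yalg_hom_add) simp_all

lemma character_mult: "character g (p * q) = character g p * character g q"
  unfolding character_def by (rule yalg_hom_mult) simp_all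

lemma character_one: "character g 1 = 1"
  unfolding character_def by (rule yalg_hom_one) simp_all

lemma character_scale: "character g (Poly_Mapping.single 0 c * p) = c * character g p"
  unfolding character_mult by (simp add: character_def yalg_hom_def ymon_eval_def)

lemma character_prod: "character g (\<Prod>x\<in>A. F x) = (\<Prod>x\<in>A. character g (F x))"
  by (induction A rule: infinite_finite_induct) (simp_all add: character_mult character_one)

text \<open>The convention \<open>Y\<^sub>w = 1\<close> for words of length at most one, transferred to coefficients.\<close>

definition unit_extension :: "'i ncps \<Rightarrow> 'i ncps" where
  "unit_extension g v = (if 2 \<le> length v then g v else 1)"

lemma character_Y: "character g (Y w) = unit_extension g w"
proof (cases "2 \<le> length w")
  case True
  then have "yalg_hom id g (Y w) = g w" by (intro yalg_hom_Y) simp_all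
  with True show ?thesis by (simp add: character_def unit_extension_def)
next
  case False
  then show ?thesis by (simp add: Y_def character_one unit_extension_def)
qed

lemma character_Y_part: "character g (Y_part w \<pi>) = Cf_part w \<pi> (unit_extension g)"
  by (simp add: Y_part_def Cf_part_def character_prod character_Y)

lemma character_cong:
  assumes "\<And>w. 2 \<le> length w \<Longrightarrow> g w = h w"
  shows "character g = character h"
proof -
  have "g (letters v) = h (letters v)" for v
    using assms[of "letters v"] letters[of v] by simp
  then have "ymon_eval g = ymon_eval h" by (simp add: ymon_eval_def fun_eq_iff)
  then show ?thesis by (simp add: character_def yalg_hom_def fun_eq_iff)
qed

lemma tensor_functional_add:
  "tensor_functional \<xi> \<eta> (s + t) = tensor_functional \<xi> \<eta> s + tensor_functional \<xi> \<eta> t"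
  unfolding tensor_functional_def case_prod_beta prod.collapse
  by (rule sum_keys_add) (simp_all add: distrib_right)

lemma tensor_functional_single:
  "tensor_functional \<xi> \<eta> (Poly_Mapping.single (m, n) c) =
    c * (\<xi> (Poly_Mapping.single m 1) * \<eta> (Poly_Mapping.single n 1))"
  by (simp add: tensor_functional_def)

lemma tensor_functional_zero: "tensor_functional \<xi> \<eta> 0 = 0"
  by (simp add: tensor_functional_def)

lemma tensor_functional_diff_left:
  "tensor_functional (\<lambda>q. \<xi> q - \<xi>' q) \<eta> t = tensor_functional \<xi> \<eta> t - tensor_functional \<xi>' \<eta> t"
  by (simp add: tensor_functional_def case_prod_beta sum_subtractf[symmetric] algebra_simps)

lemma tensor_functional_diff_right:
  "tensor_functional \<xi> (\<lambda>q. \<eta> q - \<eta>' q) t = tensor_functional \<xi> \<eta> t - tensor_functional \<xi> \<eta>' t"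
  by (simp add: tensor_functional_def case_prod_beta sum_subtractf[symmetric] algebra_simps)

lemma tensor_functional_sum:
  "tensor_functional \<xi> \<eta> (\<Sum>x\<in>A. F x) = (\<Sum>x\<in>A. tensor_functional \<xi> \<eta> (F x))"
  by (induction A rule: infinite_finite_induct) (simp_all add: tensor_functional_add tensor_functional_zero)

context
  fixes g h :: "'i ncps"
begin

abbreviation (input) "TF \<equiv> tensor_functional (character g) (character h)"

lemma tensor_character_mult: "TF (s * t) = TF s * TF t"
proof (induction s rule: single_induct)
  case (single mn c)
  obtain m n where mn: "mn = (m, n)" by (cases mn)
  show ?case
  proof (induction t rule: single_induct)
    case (single mn' d)
    obtain m' n' where mn': "mn' = (m', n')" by (cases mn')
    have *: "character k (Poly_Mapping.single (a + b) 1) =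
        character k (Poly_Mapping.single a 1) * character k (Poly_Mapping.single b 1)"
      for k :: "'i ncps" and a b
      using character_mult[of k "Poly_Mapping.single a 1" "Poly_Mapping.single b 1"]
      by (simp add: mult_single)
    show ?case by (simp add: mn mn' mult_single tensor_functional_single *)
  qed (simp_all add: tensor_functional_zero tensor_functional_add distrib_left)
qed (simp_all add: tensor_functional_zero tensor_functional_add distrib_right)

lemma tensor_character_scalar: "TF (Poly_Mapping.single 0 c) = c"
  using character_scale[of _ 1 1]
  by (simp add: zero_prod_def tensor_functional_single character_one)

lemma tensor_character_one: "TF 1 = 1"
  using tensor_character_scalar[of 1] by simp

lemma tensor_character_power: "TF (x ^ k) = TF x ^ k"
  by (induction k) (simp_all add: tensor_character_mult tensor_character_one)

lemma tensor_character_prod: "TF (\<Prod>x\<in>A. F x) = (\<Prod>x\<in>A. TF (F x))"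
  by (induction A rule: infinite_finite_induct) (simp_all add: tensor_character_mult tensor_character_one)

lemma tensor_character_ymon_eval: "TF (ymon_eval D m) = ymon_eval (\<lambda>w. TF (D w)) m"
  by (simp add: ymon_eval_def tensor_character_prod tensor_character_power)

lemma tensor_character_yalg_hom:
  "TF (yalg_hom (Poly_Mapping.single 0) D p) = character (\<lambda>w. TF (D w)) p"
  unfolding character_def[THEN fun_cong, of "\<lambda>w. TF (D w)"] yalg_hom_def
  by (simp add: tensor_functional_sum tensor_character_mult tensor_character_scalar tensor_character_ymon_eval)

text \<open>Boxed convolution of two series with linear coefficients \<open>1\<close>, of which only the coefficients
  at words of length at least two are recorded.\<close>

definition boxed_convolution :: "'i ncps" where
  "boxed_convolution w = (\<Sum>\<pi>\<in>NC (length w).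
     Cf_part w \<pi> (unit_extension g) * Cf_part w (kreweras (length w) \<pi>) (unit_extension h))"

text \<open>The comultiplication is a homomorphism and the tensor product of two characters is a character
  of the tensor square, so the convolution is determined by its values on the generators.\<close>

lemma convolution_character: "convolution (character g) (character h) = character boxed_convolution"
  unfolding convolution_def comp_def comult_def tensor_character_yalg_hom
  by (simp add: boxed_convolution_def[abs_def] tensor_functional_sum
      tensor_functional_tensor[OF character_add character_scale character_add character_scale]
      character_Y_part fun_eq_iff)

end

section \<open>Boxed convolution on mixed words\<close>

lemma length_nths_singleton: "length (nths w {x}) \<le> 1"
proof -
  have "card {i. i < length w \<and> i \<in> {x}} \<le> card {x}" by (rule card_mono) auto
  then show ?thesis by (simp add: length_nths)
qed

lemma Cf_part_zero: "Cf_part w ((\<lambda>x. {x}) ` {..<n}) (unit_extension g) = 1"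
  unfolding Cf_part_def
proof (rule prod.neutral, clarify)
  fix x
  have "\<not> 2 \<le> length (nths w {x})" using length_nths_singleton[of w x] by linarith
  then show "unit_extension g (nths w {x}) = 1" by (simp add: unit_extension_def)
qed

lemma zero_neq_one_partition: "2 \<le> (n::nat) \<Longrightarrow> (\<lambda>x. {x}) ` {..<n} \<noteq> {{..<n}}"
proof
  assume n: "2 \<le> n" and eq: "(\<lambda>x. {x}) ` {..<n} = {{..<n}}"
  have "{0} \<in> (\<lambda>x. {x}) ` {..<n}" using n by (intro imageI) simp
  then have "{0} = {..<n}" unfolding eq by simp
  then have "card {0::nat} = card {..<n}" by (rule arg_cong)
  with n show False by simp
qed

text \<open>The summands of \<open>0\<^sub>n\<close> and \<open>1\<^sub>n\<close> are \<open>g w\<close> and \<open>f w\<close>, since each of the two partitions is the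
  Kreweras complement of the other and blocks with one element contribute the factor \<open>1\<close>.\<close>

lemma boxed_convolution_extreme_terms:
  assumes "2 \<le> length w"
    and "\<And>\<pi>. \<pi> \<in> NC (length w) \<Longrightarrow> \<pi> \<noteq> {{..<length w}} \<Longrightarrow> kreweras (length w) \<pi> \<noteq> {{..<length w}} \<Longrightarrow>
      Cf_part w \<pi> (unit_extension f) * Cf_part w (kreweras (length w) \<pi>) (unit_extension g) = 0"
  shows "boxed_convolution f g w = f w + g w"
proof -
  let ?n = "length w"
  let ?zero = "(\<lambda>x. {x}) ` {..<?n}" and ?one = "{{..<?n}}"
  have n: "0 < ?n" using assms(1) by linarith
  have "boxed_convolution f g w = (\<Sum>\<pi>\<in>{?zero, ?one}.
     Cf_part w \<pi> (unit_extension f) * Cf_part w (kreweras ?n \<pi>) (unit_extension g))"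
    unfolding boxed_convolution_def
  proof (rule sum.mono_neutral_right)
    show "{?zero, ?one} \<subseteq> NC ?n" using zero_in_NC one_in_NC[OF n] by simp
    show "\<forall>\<pi>\<in>NC ?n - {?zero, ?one}.
        Cf_part w \<pi> (unit_extension f) * Cf_part w (kreweras ?n \<pi>) (unit_extension g) = 0"
    proof
      fix \<pi> assume \<pi>: "\<pi> \<in> NC ?n - {?zero, ?one}"
      then have "\<pi> \<in> NC ?n" "\<pi> \<noteq> ?zero" "\<pi> \<noteq> ?one" by simp_all
      moreover from this have "kreweras ?n \<pi> \<noteq> ?one" using kreweras_eq_one by metis
      ultimately show "Cf_part w \<pi> (unit_extension f) * Cf_part w (kreweras ?n \<pi>) (unit_extension g) = 0"
        by (intro assms(2))
    qed
  qed (rule finite_NC)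
  also have "\<dots> = f w + g w"
    using zero_neq_one_partition[OF assms(1)] assms(1) n
    by (simp add: kreweras_zero kreweras_one Cf_part_zero Cf_part_one unit_extension_def)
  finally show ?thesis .
qed

lemma mixed_length: "mixed w \<Longrightarrow> 2 \<le> length w"
proof (rule ccontr)
  assume w: "mixed w" "\<not> 2 \<le> length w"
  then consider "w = []" | x where "w = [x]" by (cases w; cases "tl w") auto
  then show False using w(1) by cases (auto simp: mixed_def)
qed

lemma letter_block_perm:
  assumes "\<pi> \<in> NC (length w)" "x < length w"
    and "\<And>B. B \<in> \<pi> \<Longrightarrow> \<not> mixed (nths w B)"
  shows "block_perm \<pi> x < length w" "w ! block_perm \<pi> x = w ! x"
proof -
  have P: "partition_on {..<length w} \<pi>" using assms(1) unfolding NC_eq_NC_on by (rule NC_on_partition)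
  obtain B where B: "B \<in> \<pi>" "x \<in> B" using assms(2) partition_onD1[OF P] by (metis UnionE lessThan_iff)
  have B': "block_perm \<pi> x \<in> B" by (rule block_perm_in_block[OF _ P B]) simp
  then show *: "block_perm \<pi> x < length w" using NC_subset[OF assms(1) B(1)] by blast
  show "w ! block_perm \<pi> x = w ! x"
    using mixed_nthsI[OF B' B(2) * assms(2)] assms(3)[OF B(1)] by blast
qed

text \<open>Otherwise both permutations preserve the letters of \<open>w\<close>, hence so does their product, which is
  the cycle \<open>x \<mapsto> x + 1\<close>; then all letters are equal.\<close>

lemma mixed_block_or_kreweras_block:
  assumes "mixed w" and \<pi>: "\<pi> \<in> NC (length w)"
  shows "\<exists>B\<in>\<pi> \<union> kreweras (length w) \<pi>. mixed (nths w B)"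
proof (rule ccontr)
  assume neg: "\<not> ?thesis"
  let ?n = "length w"
  have step: "w ! Suc x = w ! x" if "Suc x < ?n" for x
  proof -
    let ?y = "block_perm (kreweras ?n \<pi>) x"
    have x: "x < ?n" using that by simp
    have y: "?y < ?n" "w ! ?y = w ! x"
      using letter_block_perm[OF kreweras_NC[OF \<pi>] x] neg by blast+
    have "w ! block_perm \<pi> ?y = w ! ?y" using letter_block_perm(2)[OF \<pi> y(1)] neg by blast
    also have "block_perm \<pi> ?y = Suc x" using block_perm_kreweras[OF \<pi>] that by (simp add: full_cycle)
    finally show ?thesis using y(2) by simp
  qed
  have const: "w ! x = w ! 0" if "x < ?n" for x
    using that by (induction x) (simp_all add: step)
  have "set w \<subseteq> {w ! 0}" using const by (auto simp: in_set_conv_nth)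
  with assms(1) show False by (auto simp: mixed_def)
qed

text \<open>Every summand other than the two extreme ones contains the value of \<open>f\<close> or \<open>g\<close> at a shorter
  mixed word.\<close>

lemma boxed_convolution_mixed:
  assumes w: "mixed w"
    and f: "\<And>v. mixed v \<Longrightarrow> length v < length w \<Longrightarrow> f v = 0"
    and g: "\<And>v. mixed v \<Longrightarrow> length v < length w \<Longrightarrow> g v = 0"
  shows "boxed_convolution f g w = f w + g w"
proof (rule boxed_convolution_extreme_terms[OF mixed_length[OF w]])
  let ?n = "length w"
  fix \<pi> assume \<pi>: "\<pi> \<in> NC ?n" "\<pi> \<noteq> {{..<?n}}" "kreweras ?n \<pi> \<noteq> {{..<?n}}"
  note K = kreweras_NC[OF \<pi>(1)]
  have zero: "Cf_part w \<rho> (unit_extension k) = 0"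
    if "\<rho> \<in> NC ?n" "\<rho> \<noteq> {{..<?n}}" "B \<in> \<rho>" "mixed (nths w B)"
      "\<And>v. mixed v \<Longrightarrow> length v < ?n \<Longrightarrow> k v = 0" for \<rho> B k
  proof -
    have "unit_extension k (nths w B) = 0"
      using that(5)[OF that(4) length_nths_proper_block(1)[OF that(1-3)]] mixed_length[OF that(4)]
      by (simp add: unit_extension_def)
    then show ?thesis
      unfolding Cf_part_def using that(3) finite_NC_member[OF that(1)] by (intro prod_zero) auto
  qed
  obtain B where B: "B \<in> \<pi> \<union> kreweras ?n \<pi>" "mixed (nths w B)"
    using mixed_block_or_kreweras_block[OF w \<pi>(1)] by blast
  show "Cf_part w \<pi> (unit_extension f) * Cf_part w (kreweras ?n \<pi>) (unit_extension g) = 0"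
  proof (cases "B \<in> \<pi>")
    case True
    then show ?thesis using zero[OF \<pi>(1,2) _ B(2) f] by simp
  next
    case False
    then show ?thesis using zero[OF K \<pi>(3) _ B(2) g] B(1) by simp
  qed
qed

primrec box_power :: "'i ncps \<Rightarrow> nat \<Rightarrow> 'i ncps" where
  "box_power f 0 = (\<lambda>_. 0)"
| "box_power f (Suc j) = boxed_convolution f (box_power f j)"

text \<open>Each further factor adds \<open>f w\<close>, as all powers vanish on the mixed words shorter than \<open>w\<close>.\<close>

lemma box_power_mixed:
  assumes "\<And>v. mixed v \<Longrightarrow> length v < N \<Longrightarrow> f v = 0" "mixed w" "length w \<le> N"
  shows "box_power f j w = of_nat j * f w"
  using assms(2,3)
proof (induction j arbitrary: w)
  case (Suc j)
  have "box_power f j v = 0" if "mixed v" "length v < length w" for v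
    using Suc.IH[OF that(1)] assms(1)[OF that(1)] that(2) Suc.prems(2) by simp
  then have "boxed_convolution f (box_power f j) w = f w + box_power f j w"
    using Suc.prems assms(1) by (intro boxed_convolution_mixed) auto
  then show ?case using Suc by (simp add: algebra_simps)
qed simp

lemma counit_character: "counit = character (\<lambda>_. 0)"
  by (simp add: counit_def character_def)

text \<open>A partition other than \<open>0\<^sub>n\<close> has a block with at least two elements, on which the counit vanishes.\<close>

lemma convolution_counit: "convolution counit (character h) = character h"
proof -
  have "boxed_convolution (\<lambda>_. 0) h w = h w" if w: "2 \<le> length w" for w :: "'a list"
  proof -
    have "boxed_convolution (\<lambda>_. 0) h w = 0 + h w"
    proof (rule boxed_convolution_extreme_terms[OF w])
      let ?n = "length w"
      fix \<pi> assume \<pi>: "\<pi> \<in> NC ?n" "kreweras ?n \<pi> \<noteq> {{..<?n}}"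
      have P: "partition_on {..<?n} \<pi>" using \<pi>(1) unfolding NC_eq_NC_on by (rule NC_on_partition)
      have "\<exists>B\<in>\<pi>. 2 \<le> card B"
      proof (rule ccontr)
        assume c: "\<not> ?thesis"
        have "B = {x}" if "B \<in> \<pi>" "x \<in> B" for B x
        proof -
          have "finite B" using finite_block[OF _ P that(1)] by simp
          moreover have "card B \<le> Suc 0" using c that(1) by (auto simp: not_le)
          ultimately show ?thesis using that(2) by (auto simp: card_le_Suc0_iff_eq)
        qed
        then have sing: "block_perm \<pi> x = x" for x
          using block_perm_in_block[OF _ P] block_perm_outside[OF _ P] partition_onD1[OF P]
          by (metis UnionE finite_lessThan singletonD)
        then have "block_perm \<pi> = block_perm ((\<lambda>x. {x}) ` {..<?n})" by (auto simp: block_perm_zero)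
        then have "\<pi> = (\<lambda>x. {x}) ` {..<?n}"
          using P partition_on_singletons by (intro block_perm_inject[of "{..<?n}"]) auto
        moreover have "0 < ?n" using w by linarith
        ultimately show False using \<pi>(2) kreweras_zero by metis
      qed
      then obtain B where B: "B \<in> \<pi>" "2 \<le> card B" by blast
      then have "unit_extension (\<lambda>_. 0) (nths w B) = 0"
        using length_nths_card[OF NC_subset[OF \<pi>(1) B(1)]] by (simp add: unit_extension_def)
      then have "Cf_part w \<pi> (unit_extension (\<lambda>_. 0)) = 0"
        unfolding Cf_part_def using B(1) finite_NC_member[OF \<pi>(1)] by (intro prod_zero) auto
      then show "Cf_part w \<pi> (unit_extension (\<lambda>_. 0)) * Cf_part w (kreweras ?n \<pi>) (unit_extension h) = 0"
        by simp
    qed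
    then show ?thesis by simp
  qed
  then show ?thesis unfolding counit_character convolution_character by (rule character_cong)
qed

section \<open>The logarithm as a sum of iterated differences\<close>

definition drop_difference :: "(nat \<Rightarrow> complex) \<Rightarrow> nat \<Rightarrow> complex" where
  "drop_difference s j = s j - s (Suc j)"

text \<open>Convolution by the counit fixes the sequence of powers of a character and convolution by
  the character shifts it, so convolution by their difference takes differences.\<close>

lemma conv_power_eq_difference:
  "conv_power (\<lambda>q. counit q - character f q) l =
    (\<lambda>p. (drop_difference ^^ l) (\<lambda>j. character (box_power f j) p) 0)"
proof -
  let ?W = "\<lambda>l r p. (drop_difference ^^ l) (\<lambda>j. character (box_power f j) p) r"
  have W: "?W (Suc l) r = (\<lambda>p. ?W l r p - ?W l (Suc r) p)" for l r
    by (simp add: drop_difference_def)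
  have right: "convolution \<xi> (\<lambda>p. A p - B p) = (\<lambda>p. convolution \<xi> A p - convolution \<xi> B p)"
    for \<xi> A B :: "'a yalg \<Rightarrow> complex"
    by (simp add: convolution_def fun_eq_iff tensor_functional_diff_right)
  have left: "convolution (\<lambda>p. A p - B p) \<eta> = (\<lambda>p. convolution A \<eta> p - convolution B \<eta> p)"
    for \<eta> A B :: "'a yalg \<Rightarrow> complex"
    by (simp add: convolution_def fun_eq_iff tensor_functional_diff_left)
  have counit: "convolution counit (?W l r) = ?W l r" for l r
  proof (induction l arbitrary: r)
    case 0
    show ?case by (simp add: convolution_counit)
  next
    case (Suc l)
    show ?case unfolding W right Suc.IH ..
  qed
  have shift: "convolution (character f) (?W l r) = ?W l (Suc r)" for l r
  proof (induction l arbitrary: r)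
    case 0
    show ?case by (simp add: convolution_character)
  next
    case (Suc l)
    show ?case unfolding W right Suc.IH ..
  qed
  show ?thesis
  proof (induction l)
    case 0
    show ?case by (simp add: counit_character)
  next
    case (Suc l)
    show ?case unfolding conv_power.simps Suc.IH W left counit shift ..
  qed
qed

lemma LS_eq_differences:
  assumes "2 \<le> length w"
  shows "LS \<mu> w = - suminf (\<lambda>l. 1 / of_nat (Suc l) *
    (drop_difference ^^ Suc l) (\<lambda>j. box_power (R_transform \<mu>) j w) 0)"
proof -
  have *: "character g (Y w) = g w" for g using assms by (simp add: character_Y unit_extension_def)
  show ?thesis using assms unfolding LS_def conv_log_def chi_def character_def[symmetric] conv_power_eq_difference * by simp
qed

text \<open>Only the term \<open>l = 1\<close> of the logarithm sees a linear sequence, and it yields minus the slope.\<close>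

lemma drop_difference_linear:
  "(drop_difference ^^ Suc l) (\<lambda>j. of_nat j * c) 0 = (if l = 0 then - c else 0)"
proof -
  have 1: "drop_difference (\<lambda>j. of_nat j * c) = (\<lambda>_. - c)"
    by (simp add: drop_difference_def fun_eq_iff algebra_simps)
  have 2: "drop_difference (\<lambda>_. d) = (\<lambda>_. 0)" for d by (simp add: drop_difference_def fun_eq_iff)
  have 3: "(drop_difference ^^ k) (\<lambda>_. 0) = (\<lambda>_. 0)" for k by (induction k) (simp_all add: 2)
  show ?thesis
  proof (cases l)
    case (Suc k)
    then show ?thesis by (simp only: funpow_Suc_right comp_def 1 2 3) simp
  qed (simp add: 1)
qed

text \<open>The powers of the character of \<open>f = R\<^sub>\<mu>\<close> take the values \<open>j f(w)\<close> at \<open>Y\<^sub>w\<close>, a linear sequence of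
  slope \<open>f(w)\<close>.\<close>

lemma LS_mixed:
  assumes "mixed w" "\<And>v. mixed v \<Longrightarrow> length v < length w \<Longrightarrow> R_transform \<mu> v = 0"
  shows "LS \<mu> w = R_transform \<mu> w"
proof -
  let ?c = "R_transform \<mu> w"
  have "LS \<mu> w = - suminf (\<lambda>l. 1 / of_nat (Suc l) * (if l = 0 then - ?c else 0))"
    unfolding LS_eq_differences[OF mixed_length[OF assms(1)]]
    by (simp only: box_power_mixed[OF assms(2,1) order_refl] drop_difference_linear)
  also have "suminf (\<lambda>l. 1 / of_nat (Suc l) * (if l = 0 then - ?c else 0)) =
      (\<Sum>l\<in>{0}. 1 / of_nat (Suc l) * (if l = 0 then - ?c else 0))"
    by (rule suminf_finite) auto
  finally show ?thesis by simp
qed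

lemma LS_mixed_vanish_iff:
  "(\<forall>w. mixed w \<longrightarrow> LS \<mu> w = 0) \<longleftrightarrow> (\<forall>w. mixed w \<longrightarrow> R_transform \<mu> w = 0)"
proof
  assume "\<forall>w. mixed w \<longrightarrow> R_transform \<mu> w = 0"
  then show "\<forall>w. mixed w \<longrightarrow> LS \<mu> w = 0" using LS_mixed[of _ \<mu>] by simp
next
  assume LS: "\<forall>w. mixed w \<longrightarrow> LS \<mu> w = 0"
  show "\<forall>w. mixed w \<longrightarrow> R_transform \<mu> w = 0"
  proof
    fix w show "mixed w \<longrightarrow> R_transform \<mu> w = 0"
    proof (induction w rule: length_induct)
      case (1 w)
      then show ?case using LS_mixed[of w \<mu>] LS by auto
    qed
  qed
qed

section \<open>Renaming letters\<close>

lemma boxed_convolution_map: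
  "boxed_convolution f g (map h w) = boxed_convolution (\<lambda>v. f (map h v)) (\<lambda>v. g (map h v)) w"
  by (simp add: boxed_convolution_def Cf_part_def unit_extension_def nths_map)

lemma box_power_map: "box_power f j (map h w) = box_power (\<lambda>v. f (map h v)) j w"
proof -
  have "(\<lambda>w. box_power f j (map h w)) = box_power (\<lambda>v. f (map h v)) j"
    by (induction j) (simp_all add: boxed_convolution_map)
  then show ?thesis by metis
qed

lemma LS_map:
  assumes "\<And>v. R_transform \<nu> v = R_transform \<mu> (map h v)"
  shows "LS \<nu> w = LS \<mu> (map h w)"
proof (cases "2 \<le> length w")
  case True
  have "R_transform \<nu> = (\<lambda>v. R_transform \<mu> (map h v))" using assms by blast
  then show ?thesis using True by (simp add: LS_eq_differences box_power_map)
qed (simp add: LS_def)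

lemma R_transform_distribution:
  "R_transform (distribution \<phi> a) = cumulant (\<lambda>w. \<phi> (prod_list (map a w)))"
  by (simp add: R_transform_eq_cumulant distribution_word)

section \<open>Separation of variables\<close>

lemma separated_mixed:
  fixes u :: "'i::finite \<Rightarrow> complex fps"
  shows "mixed w \<Longrightarrow> (\<Sum>i\<in>UNIV. in_variable (u i) i w) = 0"
  by (simp add: in_variable_def mixed_def)

lemma separated_replicate:
  fixes u :: "'i::finite \<Rightarrow> complex fps"
  assumes "0 < n"
  shows "(\<Sum>i\<in>UNIV. in_variable (u i) i (replicate n j)) = fps_nth (u j) n"
proof -
  have "in_variable (u i) i (replicate n j) = (if i = j then fps_nth (u j) n else 0)" for i
    using assms by (auto simp: in_variable_def)
  then show ?thesis by simp
qed

theorem proposition5p4: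
  fixes sc :: "complex \<Rightarrow> 'a::ring_1 \<Rightarrow> 'a"
    and \<phi> :: "'a \<Rightarrow> complex"
    and a :: "'i::finite \<Rightarrow> 'a"
    and \<mu> :: "'i ncpoly \<Rightarrow> complex"
    and \<mu>s :: "'i \<Rightarrow> unit ncpoly \<Rightarrow> complex"
  assumes "nc_probability_space sc \<phi>"
    and "\<And>i. \<phi> (a i) = 1"
    and "\<mu> = distribution \<phi> a"
    and "\<And>i. \<mu>s i = distribution \<phi> (\<lambda>_. a i)"
  shows "(freely_independent sc \<phi> a \<longleftrightarrow>
            (\<exists>u :: 'i \<Rightarrow> complex fps. LS \<mu> = (\<lambda>w. \<Sum>i\<in>UNIV. in_variable (u i) i w)))
       \<and> (freely_independent sc \<phi> a \<longleftrightarrow>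
            LS \<mu> = (\<lambda>w. \<Sum>i\<in>UNIV. in_variable (LS1 (\<mu>s i)) i w))"
proof -
  interpret nc_probability_space sc \<phi> by (rule assms(1))
  have free: "freely_independent sc \<phi> a \<longleftrightarrow> (\<forall>w. mixed w \<longrightarrow> LS \<mu> w = 0)"
    unfolding freely_independent_iff_free_moments LS_mixed_vanish_iff assms(3) R_transform_distribution
    by (rule free_moments_iff_mixed_cumulants_vanish) (simp add: functional_one)
  have marginal: "LS (\<mu>s i) (replicate n ()) = LS \<mu> (replicate n i)" for i n
  proof -
    have "R_transform (\<mu>s i) v = R_transform \<mu> (map (\<lambda>_. i) v)" for v
      unfolding assms(3,4) R_transform_distribution cumulant_map by (simp add: comp_def)
    from LS_map[OF this] show ?thesis by simp
  qed
  have separated: "LS \<mu> = (\<lambda>w. \<Sum>i\<in>UNIV. in_variable (LS1 (\<mu>s i)) i w)"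
    if "\<forall>w. mixed w \<longrightarrow> LS \<mu> w = 0"
  proof
    fix w :: "'i list"
    consider "mixed w" | "w = []" | n i where "w = replicate n i" "0 < n"
      using not_mixed_iff_replicate[of w] by (cases "w = []") auto
    then show "LS \<mu> w = (\<Sum>i\<in>UNIV. in_variable (LS1 (\<mu>s i)) i w)"
    proof cases
      case 1
      then show ?thesis using that by (simp add: separated_mixed)
    next
      case 2
      then show ?thesis by (simp add: LS_def LS1_def in_variable_def)
    next
      case 3
      then show ?thesis by (simp add: separated_replicate LS1_def marginal)
    qed
  qed
  have vanish: "\<forall>w. mixed w \<longrightarrow> LS \<mu> w = 0"
    if "LS \<mu> = (\<lambda>w. \<Sum>i\<in>UNIV. in_variable (u i) i w)" for u
    unfolding that by (simp add: separated_mixed)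
  show ?thesis
    unfolding free
  proof (intro conjI iffI)
    assume "\<forall>w. mixed w \<longrightarrow> LS \<mu> w = 0"
    then show "LS \<mu> = (\<lambda>w. \<Sum>i\<in>UNIV. in_variable (LS1 (\<mu>s i)) i w)" by (rule separated)
    then show "\<exists>u :: 'i \<Rightarrow> complex fps. LS \<mu> = (\<lambda>w. \<Sum>i\<in>UNIV. in_variable (u i) i w)"
      by (intro exI[of _ "\<lambda>i. LS1 (\<mu>s i)"])
  next
    assume "\<exists>u :: 'i \<Rightarrow> complex fps. LS \<mu> = (\<lambda>w. \<Sum>i\<in>UNIV. in_variable (u i) i w)"
    then show "\<forall>w. mixed w \<longrightarrow> LS \<mu> w = 0" by (elim exE vanish)
  qed (rule vanish)
qed

end
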